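(* Let $T$ be a (not necessarily closed, not necessarily closable, possibly multivalued) linear relation from a Hilbert space $\mathfrak{H}$ to a Hilbert space $\mathfrak{K}$, let $B\in\mathbf{B}(\mathfrak{K})$ be selfadjoint, and let $S=T^*(I+iB)T$. Let $\mathfrak{M}$, $B_m$, $Q$ and $J$ be associated with $T^*(I+iB)T$ as in the context. Then the following statements hold. (i) The Friedrichs extension $S_F$ of $S$ is given by $$S_F=Q^*(I+iB_m)Q^{**}$$ and the corresponding closed form $\mathfrak{t}_{S_F}$ is given by $$\mathfrak{t}_{S_F}[h,k]=\big((I+iB_m)Q^{**}h,Q^{**}k\big),\quad h,k\in\operatorname{dom}Q^{**}.$$ (ii) The Krein extension $S_K$ of $S$ is given by $$S_K=J^{**}(I+iB_m)J^{*}$$ and the corresponding closed form $\mathfrak{t}_{S_K}$ is given by $$\mathfrak{t}_{S_K}[h,k]=\big((I+iB_m)J^{*}h,J^{*}k\big),\quad h,k\in\operatorname{dom}J^{*}.$$ In particular, $S_K$ is an operator if and only if $T$ is densely defined. Therefore $S=T^*(I+iB)T$ admits a maximal sectorial operator extension precisely when $T$ is densely defined.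
   Context: Hilbert spaces are complex with inner product linear in the first entry; $\mathbf{B}(\mathfrak{K})$ is the set of bounded everywhere defined operators on $\mathfrak{K}$. A linear relation $T$ from $\mathfrak{H}$ to $\mathfrak{K}$ is a linear subspace of $\mathfrak{H}\times\mathfrak{K}$; operators are identified with their graphs. $\operatorname{dom}T$, $\operatorname{ran}T$ are the sets of first, respectively second, entries; $T^{-1}=\{\{g,f\}:\{f,g\}\in T\}$. The adjoint is $T^*=\{\{k,h\}\in\mathfrak{K}\times\mathfrak{H}:(k,f')=(h,f)\text{ for all }\{f,f'\}\in T\}$, and $T^{**}$ is the closure of $T$. Products: $AB=\{\{f,h\}:\{f,g\}\in B,\ \{g,h\}\in A\text{ for some }g\}$. A linear relation $S$ in $\mathfrak{H}$ is sectorial (with vertex at the origin and semi-angle $\alpha\in[0,\pi/2)$) if $|\operatorname{Im}(h',h)|\le(\tan\alpha)\operatorname{Re}(h',h)$ for all $\{h,h'\}\in S$; it is maximal sectorial if it has no proper sectorial extension in $\mathfrak{H}$. If $S$ is sectorial, so is $S^{-1}$. The relation $T^*(I+iB)T$ is sectorial. For a sectorial relation $S$ the form $\mathfrak{t}_S[\varphi,\psi]=(\varphi',\psi)$, $\{\varphi,\varphi'\},\{\psi,\psi'\}\in S$, with $\operatorname{dom}\mathfrak{t}_S=\operatorname{dom}S$, is well defined, sectorial and closable. Closed (not necessarily densely defined) sectorial forms $\mathfrak{t}$ in $\mathfrak{H}$ and maximal sectorial relations are in one-to-one correspondence via $H_{\mathfrak{t}}=\{\{\varphi,\varphi'\}\in\mathfrak{H}\times\mathfrak{H}:\varphi\in\operatorname{dom}\mathfrak{t},\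 \mathfrak{t}[\varphi,\psi]=(\varphi',\psi)\ \forall\psi\in\operatorname{dom}\mathfrak{t}\}$. The Friedrichs extension $S_F$ of $S$ is the maximal sectorial relation corresponding to the closure of $\mathfrak{t}_S$; the Krein extension is $S_K=((S^{-1})_F)^{-1}$. The closed forms corresponding to $S_F$ and $S_K$ are denoted $\mathfrak{t}_{S_F}$ and $\mathfrak{t}_{S_K}$. Given $T$ and $B$, put $\mathfrak{M}_0=\{\alpha\in\mathfrak{K}:\alpha\in\operatorname{ran}T,\ (I+iB)\alpha\in\operatorname{dom}T^*\}$; let $\mathfrak{M}$ be the closure of $\mathfrak{M}_0$ in $\mathfrak{K}$, let $P_{\mathfrak{M}}$ be the orthogonal projection onto $\mathfrak{M}$, and let $B_m=P_{\mathfrak{M}}B|_{\mathfrak{M}}\in\mathbf{B}(\mathfrak{M})$. Define the linear relation $Q$ from $\mathfrak{H}$ to $\mathfrak{M}$ and the linear relation $J$ from $\mathfrak{M}$ to $\mathfrak{H}$ by $$Q=\{\{\varphi,\alpha\}\in T:\alpha\in\mathfrak{M}_0\},$$ $$J=\{\{(I+iB_m)\alpha,\varphi'\}:\alpha\in\mathfrak{M}_0,\ \{(I+iB)\alpha,\varphi'\}\in T^*\}.$$ Adjoints of $Q$ and $J$ are taken with respect to $\mathfrak{H}$ and $\mathfrak{M}$. ($Q$ is a closable operator and $J$ is densely defined, so $Q^{**}$ and $J^*$ are operators.) *)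

theory Defs
  imports "HOL-Analysis.Analysis"
begin

section \<open>Complex Hilbert spaces\<close>

class scaleC =
  fixes scaleC :: "complex \<Rightarrow> 'a \<Rightarrow> 'a" (infixr "*\<^sub>C" 75)

class complex_vector = real_vector + scaleC +
  assumes scaleC_add_right: "a *\<^sub>C (x + y) = a *\<^sub>C x + a *\<^sub>C y"
    and scaleC_add_left: "(a + b) *\<^sub>C x = a *\<^sub>C x + b *\<^sub>C x"
    and scaleC_scaleC: "a *\<^sub>C b *\<^sub>C x = (a * b) *\<^sub>C x"
    and scaleC_one: "1 *\<^sub>C x = x"
    and scaleR_scaleC: "r *\<^sub>R x = complex_of_real r *\<^sub>C x"

global_interpretation complex_vector:
  vector_space "scaleC :: complex \<Rightarrow> 'a \<Rightarrow> 'a::complex_vector"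
  defines csubspace_raw_def: csubspace = complex_vector.subspace
  by unfold_locales (simp_all add: scaleC_add_right scaleC_add_left scaleC_scaleC scaleC_one)

text \<open>The inner product \<open>cinner\<close> is linear in its first argument. Its real part is the real inner
  product of the underlying real space, so positive definiteness, the norm and the topology are
  those of the class \<open>real_inner\<close>.\<close>

class complex_inner = complex_vector + real_inner +
  fixes cinner :: "'a \<Rightarrow> 'a \<Rightarrow> complex"
  assumes cinner_add_left: "cinner (x + y) z = cinner x z + cinner y z"
    and cinner_scaleC_left: "cinner (a *\<^sub>C x) y = a * cinner x y"
    and cinner_commute: "cinner x y = cnj (cinner y x)"
    and inner_eq_Re_cinner: "inner x y = Re (cinner x y)"

class chilbert_space = complex_inner + complete_space

instantiation complex :: chilbert_space
begin

definition scaleC_complex :: "complex \<Rightarrow> complex \<Rightarrow> complex" where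
  "scaleC_complex a x = a * x"

definition cinner_complex :: "complex \<Rightarrow> complex \<Rightarrow> complex" where
  "cinner_complex x y = x * cnj y"

instance
  by standard
    (simp_all add: scaleC_complex_def cinner_complex_def algebra_simps scaleR_conv_of_real
      inner_complex_def)

end

instantiation prod :: (complex_vector, complex_vector) complex_vector
begin

definition scaleC_prod :: "complex \<Rightarrow> 'a \<times> 'b \<Rightarrow> 'a \<times> 'b" where
  "scaleC_prod a x = (a *\<^sub>C fst x, a *\<^sub>C snd x)"

instance
  by standard
    (simp_all add: scaleC_prod_def prod_eq_iff scaleC_add_right scaleC_add_left scaleC_scaleC
      scaleC_one scaleR_scaleC)

end

definition bounded_clinear :: "('a::complex_inner \<Rightarrow> 'b::complex_inner) \<Rightarrow> bool" where
  "bounded_clinear A \<longleftrightarrow> bounded_linear A \<and> (\<forall>c x. A (c *\<^sub>C x) = c *\<^sub>C A x)"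

definition orth_proj :: "'a::complex_inner set \<Rightarrow> 'a \<Rightarrow> 'a" where
  "orth_proj M x = (THE y. y \<in> M \<and> (\<forall>z\<in>M. cinner (x - y) z = 0))"

section \<open>Linear relations\<close>

text \<open>A linear relation is a set of pairs that is a \<open>csubspace\<close> of the product space. It is an
  operator when it is \<open>single_valued\<close>. The product \<open>A \<odot> B\<close> applies \<open>B\<close> first.\<close>

abbreviation rel_product :: "('b \<times> 'c) set \<Rightarrow> ('a \<times> 'b) set \<Rightarrow> ('a \<times> 'c) set" (infixr "\<odot>" 75) where
  "A \<odot> B \<equiv> B O A"

definition graph_on :: "'a set \<Rightarrow> ('a \<Rightarrow> 'b) \<Rightarrow> ('a \<times> 'b) set" where
  "graph_on X A = {(x, A x) | x. x \<in> X}"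

definition rel_app :: "('a \<times> 'b) set \<Rightarrow> 'a \<Rightarrow> 'b" where
  "rel_app R x = (THE y. (x, y) \<in> R)"

text \<open>\<open>rel_adjoint X Y T\<close> is the adjoint of a linear relation \<open>T\<close> from \<open>X\<close> to \<open>Y\<close>, where \<open>X\<close> and \<open>Y\<close> are
  closed subspaces regarded as Hilbert spaces in their own right.\<close>

definition rel_adjoint ::
  "'a::complex_inner set \<Rightarrow> 'b::complex_inner set \<Rightarrow> ('a \<times> 'b) set \<Rightarrow> ('b \<times> 'a) set" where
  "rel_adjoint X Y T =
    {(k, h). k \<in> Y \<and> h \<in> X \<and> (\<forall>(f, f') \<in> T. cinner k f' = cinner h f)}"

definition selfadjoint_op :: "('a::complex_inner \<Rightarrow> 'a) \<Rightarrow> bool" where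
  "selfadjoint_op B \<longleftrightarrow> rel_adjoint UNIV UNIV (graph_on UNIV B) = graph_on UNIV B"

text \<open>The values lie in the sector \<open>{z. \<bar>Im z\<bar> \<le> tan \<alpha> * Re z}\<close> of the right half-plane. The condition
  \<open>0 \<le> Re z\<close> follows from the other inequality if \<open>\<alpha> > 0\<close>; for \<open>\<alpha> = 0\<close>, where that inequality reduces
  to \<open>Im z = 0\<close>, it makes the sector the half-line \<open>[0, \<infinity>)\<close>.\<close>

definition sectorial :: "('a::complex_inner \<times> 'a) set \<Rightarrow> bool" where
  "sectorial S \<longleftrightarrow> csubspace S \<and>
    (\<exists>\<alpha>. 0 \<le> \<alpha> \<and> \<alpha> < pi / 2 \<and>
      (\<forall>(h, h') \<in> S. 0 \<le> Re (cinner h' h) \<and>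
        \<bar>Im (cinner h' h)\<bar> \<le> tan \<alpha> * Re (cinner h' h)))"

definition maximal_sectorial :: "('a::complex_inner \<times> 'a) set \<Rightarrow> bool" where
  "maximal_sectorial S \<longleftrightarrow> sectorial S \<and> (\<forall>S'. sectorial S' \<and> S \<subseteq> S' \<longrightarrow> S' = S)"

section \<open>Sectorial forms\<close>

text \<open>A form is a pair of a domain and a function on pairs of vectors. The function is required to
  vanish outside the domain, so that equality of pairs is equality of forms.\<close>

type_synonym 'a form = "'a set \<times> ('a \<Rightarrow> 'a \<Rightarrow> complex)"

definition mk_form :: "'a set \<Rightarrow> ('a \<Rightarrow> 'a \<Rightarrow> complex) \<Rightarrow> 'a form" where
  "mk_form D f = (D, \<lambda>\<phi> \<psi>. if \<phi> \<in> D \<and> \<psi> \<in> D then f \<phi> \<psi> else 0)"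

abbreviation form_dom :: "'a form \<Rightarrow> 'a set" where "form_dom \<equiv> fst"

abbreviation form_val :: "'a form \<Rightarrow> 'a \<Rightarrow> 'a \<Rightarrow> complex" where "form_val \<equiv> snd"

definition sesquilinear_form :: "'a::complex_inner form \<Rightarrow> bool" where
  "sesquilinear_form t \<longleftrightarrow> csubspace (form_dom t) \<and>
    (\<forall>\<phi> \<psi>. \<phi> \<notin> form_dom t \<or> \<psi> \<notin> form_dom t \<longrightarrow> form_val t \<phi> \<psi> = 0) \<and>
    (\<forall>\<phi>\<in>form_dom t. \<forall>\<psi>\<in>form_dom t. \<forall>\<theta>\<in>form_dom t. \<forall>c.
      form_val t (\<phi> + \<psi>) \<theta> = form_val t \<phi> \<theta> + form_val t \<psi> \<theta> \<and>
      form_val t (c *\<^sub>C \<phi>) \<theta> = c * form_val t \<phi> \<theta> \<and>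
      form_val t \<theta> (\<phi> + \<psi>) = form_val t \<theta> \<phi> + form_val t \<theta> \<psi> \<and>
      form_val t \<theta> (c *\<^sub>C \<phi>) = cnj c * form_val t \<theta> \<phi>)"

definition sectorial_form :: "'a::complex_inner form \<Rightarrow> bool" where
  "sectorial_form t \<longleftrightarrow> sesquilinear_form t \<and>
    (\<exists>\<alpha>. 0 \<le> \<alpha> \<and> \<alpha> < pi / 2 \<and>
      (\<forall>\<phi>\<in>form_dom t. 0 \<le> Re (form_val t \<phi> \<phi>) \<and>
        \<bar>Im (form_val t \<phi> \<phi>)\<bar> \<le> tan \<alpha> * Re (form_val t \<phi> \<phi>)))"

definition closed_sectorial_form :: "'a::complex_inner form \<Rightarrow> bool" where
  "closed_sectorial_form t \<longleftrightarrow> sectorial_form t \<and>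
    (\<forall>s \<phi>. (\<forall>n. s n \<in> form_dom t) \<and> s \<longlonglongrightarrow> \<phi> \<and>
      (\<forall>e>0. \<exists>N. \<forall>m\<ge>N. \<forall>n\<ge>N. cmod (form_val t (s n - s m) (s n - s m)) < e) \<longrightarrow>
      \<phi> \<in> form_dom t \<and> (\<lambda>n. form_val t (s n - \<phi>) (s n - \<phi>)) \<longlonglongrightarrow> 0)"

definition form_extends :: "'a form \<Rightarrow> 'a form \<Rightarrow> bool" where
  "form_extends u t \<longleftrightarrow> form_dom t \<subseteq> form_dom u \<and>
    (\<forall>\<phi>\<in>form_dom t. \<forall>\<psi>\<in>form_dom t. form_val u \<phi> \<psi> = form_val t \<phi> \<psi>)"

text \<open>The closure of a closable sectorial form is its smallest closed extension.\<close>

definition form_closure :: "'a::complex_inner form \<Rightarrow> 'a form" where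
  "form_closure t = (THE u. closed_sectorial_form u \<and> form_extends u t \<and>
    (\<forall>v. closed_sectorial_form v \<and> form_extends v t \<longrightarrow> form_extends v u))"

definition form_of_rel :: "('a::complex_inner \<times> 'a) set \<Rightarrow> 'a form" where
  "form_of_rel S = mk_form (Domain S)
    (\<lambda>\<phi> \<psi>. THE z. \<exists>\<phi>'. (\<phi>, \<phi>') \<in> S \<and> z = cinner \<phi>' \<psi>)"

definition rel_of_form :: "'a::complex_inner form \<Rightarrow> ('a \<times> 'a) set" where
  "rel_of_form t =
    {(\<phi>, \<phi>'). \<phi> \<in> form_dom t \<and> (\<forall>\<psi>\<in>form_dom t. form_val t \<phi> \<psi> = cinner \<phi>' \<psi>)}"

text \<open>The closed form corresponding to a maximal sectorial relation \<open>H\<close>, that is, the inverse of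
  \<open>rel_of_form\<close> on closed sectorial forms.\<close>

definition closed_form_of :: "('a::complex_inner \<times> 'a) set \<Rightarrow> 'a form" where
  "closed_form_of H = (THE t. closed_sectorial_form t \<and> rel_of_form t = H)"

definition friedrichs_ext :: "('a::complex_inner \<times> 'a) set \<Rightarrow> ('a \<times> 'a) set" where
  "friedrichs_ext S = rel_of_form (form_closure (form_of_rel S))"

definition krein_ext :: "('a::complex_inner \<times> 'a) set \<Rightarrow> ('a \<times> 'a) set" where
  "krein_ext S = (friedrichs_ext (S\<inverse>))\<inverse>"

section \<open>The objects associated with \<open>T\<^sup>*(I + iB)T\<close>\<close>

definition I_plus_i :: "('a::complex_vector \<Rightarrow> 'a) \<Rightarrow> 'a \<Rightarrow> 'a" where
  "I_plus_i B x = x + \<i> *\<^sub>C B x"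

definition sect_product ::
  "('h::complex_inner \<times> 'k::complex_inner) set \<Rightarrow> ('k \<Rightarrow> 'k) \<Rightarrow> ('h \<times> 'h) set" where
  "sect_product T B = rel_adjoint UNIV UNIV T \<odot> graph_on UNIV (I_plus_i B) \<odot> T"

definition M0_of ::
  "('h::complex_inner \<times> 'k::complex_inner) set \<Rightarrow> ('k \<Rightarrow> 'k) \<Rightarrow> 'k set" where
  "M0_of T B = {\<alpha>. \<alpha> \<in> Range T \<and> I_plus_i B \<alpha> \<in> Domain (rel_adjoint UNIV UNIV T)}"

definition M_of ::
  "('h::complex_inner \<times> 'k::complex_inner) set \<Rightarrow> ('k \<Rightarrow> 'k) \<Rightarrow> 'k set" where
  "M_of T B = closure (M0_of T B)"

text \<open>Only the values of \<open>Bm_of T B\<close> on \<open>M_of T B\<close> are meaningful.\<close>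

definition Bm_of ::
  "('h::complex_inner \<times> 'k::complex_inner) set \<Rightarrow> ('k \<Rightarrow> 'k) \<Rightarrow> 'k \<Rightarrow> 'k" where
  "Bm_of T B \<alpha> = orth_proj (M_of T B) (B \<alpha>)"

definition Q_of ::
  "('h::complex_inner \<times> 'k::complex_inner) set \<Rightarrow> ('k \<Rightarrow> 'k) \<Rightarrow> ('h \<times> 'k) set" where
  "Q_of T B = {(\<phi>, \<alpha>). (\<phi>, \<alpha>) \<in> T \<and> \<alpha> \<in> M0_of T B}"

definition J_of ::
  "('h::complex_inner \<times> 'k::complex_inner) set \<Rightarrow> ('k \<Rightarrow> 'k) \<Rightarrow> ('k \<times> 'h) set" where
  "J_of T B = {(I_plus_i (Bm_of T B) \<alpha>, \<phi>') | \<alpha> \<phi>'.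
    \<alpha> \<in> M0_of T B \<and> (I_plus_i B \<alpha>, \<phi>') \<in> rel_adjoint UNIV UNIV T}"

end

theory Submission
  imports Defs
begin

text \<open>The form of \<open>S = T\<^sup>*(I + iB)T\<close> is \<open>((I + iB\<^sub>m)Qh, Qk)\<close> on \<open>dom S = dom Q\<close>, and the form of \<open>S\<^sup>-\<^sup>1\<close>, expressed
  by the operator \<open>J\<^sup>-\<^sup>1\<close>, is \<open>((I + iB\<^sub>m)\<^sup>-\<^sup>1J\<^sup>-\<^sup>1h, J\<^sup>-\<^sup>1k)\<close>. Both \<open>I + iB\<^sub>m\<close> and its inverse are coercive
  on \<open>M\<close>, so both forms have the shape \<open>(A R h, R k)\<close> with a closable operator \<open>R\<close> and a bounded coercive
  \<open>A\<close>. The closure of such a form belongs to the closure of \<open>R\<close>, and its maximal sectorial relation is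
  \<open>R\<^sup>*AR\<^sup>*\<^sup>*\<close>. Closability of \<open>Q\<close> and of \<open>J\<^sup>-\<^sup>1\<close> follows from \<open>J \<subseteq> Q\<^sup>*\<close>. The closed form of a maximal
  sectorial relation is unique since the domain of the relation is a core of the form, by Lax--Milgram.
  Finally, any extension of \<open>S\<close> contains \<open>{0} \<times> mul T\<^sup>*\<close>, while \<open>dom T \<subseteq> dom J\<^sup>*\<close>.\<close>

section \<open>The Lax--Milgram theorem\<close>

text \<open>\<open>M\<close> is a subspace and not a type, so the Hilbert space arguments run over
  an explicit carrier with an explicit inner product. A single real Lax--Milgram theorem then serves
  for projections, for the inverse of the coercive operator on \<open>M\<close>, for the equation
  \<open>(H + I) u = x\<close> of a form, and for the adjoint equations. The compression to
  \<open>M\<close> succeeds because pairing \<open>Q\<close> with \<open>J\<close> never leaves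
  \<open>M\<close>: for \<open>\<alpha>\<close>, \<open>\<beta>\<close> in \<open>M0\<close> the
  product of \<open>(I + iB) \<alpha>\<close> and \<open>\<beta>\<close> is unchanged when
  \<open>B\<close> is replaced by \<open>Bm\<close>. Both \<open>M0\<close> and its image under
  \<open>I + i Bm\<close> are dense in \<open>M\<close>, which turns the pairing into closability
  although \<open>T\<close> itself may be multivalued. Closures and closed forms are definite
  descriptions, so every formula needs existence and uniqueness. One fact about cores gives both the
  minimality of the closure and the uniqueness of the form of a relation. The formula for the Krein
  extension comes from the form of the inverse of \<open>S\<close>, but its closed form does not: it
  comes from \<open>J_adj\<close>, which is a closed operator and generates the same
  relation.\<close>

lemma quadratic_nonneg_imp:
  fixes a b c :: real
  assumes "\<And>t. 0 \<le> a * t\<^sup>2 + 2 * b * t + c" "0 \<le> a"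
  shows "b\<^sup>2 \<le> a * c"
proof (cases "a = 0")
  case True
  have "b = 0"
  proof (rule ccontr)
    assume "b \<noteq> 0"
    \<comment> \<open>The chosen \<open>t\<close> gives the linear polynomial the value -1.\<close>
    then show False
      using assms(1)[of "- (c + 1) / (2 * b)"] True by simp
  qed
  then show ?thesis using True by simp
next
  case False
  then have "a > 0" using assms(2) by simp
  moreover have "0 \<le> a * (- b / a)\<^sup>2 + 2 * b * (- b / a) + c"
    by (rule assms(1))
  ultimately show ?thesis
    by (simp add: field_simps power2_eq_square)
qed

lemma tendsto_0_if_square_le:
  fixes x :: "nat \<Rightarrow> 'a::real_normed_vector"
  assumes "\<And>n. (norm (x n))\<^sup>2 \<le> y n" "y \<longlonglongrightarrow> 0"
  shows "x \<longlonglongrightarrow> 0"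
proof (rule Lim_null_comparison)
  show "\<forall>\<^sub>F n in sequentially. norm (x n) \<le> sqrt (y n)"
    using assms(1) by (simp add: real_le_rsqrt)
  show "(\<lambda>n. sqrt (y n)) \<longlonglongrightarrow> 0"
    using tendsto_real_sqrt[OF assms(2)] by simp
qed

text \<open>The carrier and the inner product are parameters because three kinds of instances occur:
  closed subspaces with \<open>inner\<close>, form domains with the form inner product, and renormed
  versions of these. The scalars are real since coercivity concerns real parts only.\<close>

locale hilbert_form =
  fixes V :: "'a::real_vector set" and g :: "'a \<Rightarrow> 'a \<Rightarrow> real"
  assumes subspace: "subspace V"
    and sym: "\<And>u v. \<lbrakk>u \<in> V; v \<in> V\<rbrakk> \<Longrightarrow> g u v = g v u"
    and add_left: "\<And>u v w. \<lbrakk>u \<in> V; v \<in> V; w \<in> V\<rbrakk> \<Longrightarrow> g (u + v) w = g u w + g v w"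
    and scale_left: "\<And>r u v. \<lbrakk>u \<in> V; v \<in> V\<rbrakk> \<Longrightarrow> g (r *\<^sub>R u) v = r * g u v"
    and pos: "\<And>u. \<lbrakk>u \<in> V; u \<noteq> 0\<rbrakk> \<Longrightarrow> 0 < g u u"
    and complete: "\<And>s. \<lbrakk>\<And>n. s n \<in> V;
        \<And>e. e > 0 \<Longrightarrow> \<exists>N. \<forall>m\<ge>N. \<forall>n\<ge>N. g (s n - s m) (s n - s m) < e\<rbrakk>
      \<Longrightarrow> \<exists>l\<in>V. (\<lambda>n. g (s n - l) (s n - l)) \<longlonglongrightarrow> 0"
begin

lemma closed_ops [simp, intro]:
  "0 \<in> V" "\<lbrakk>u \<in> V; v \<in> V\<rbrakk> \<Longrightarrow> u + v \<in> V" "\<lbrakk>u \<in> V; v \<in> V\<rbrakk> \<Longrightarrow> u - v \<in> V"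
  "u \<in> V \<Longrightarrow> r *\<^sub>R u \<in> V"
  using subspace by (auto simp: subspace_0 subspace_add subspace_diff subspace_scale)

lemma add_right: "\<lbrakk>u \<in> V; v \<in> V; w \<in> V\<rbrakk> \<Longrightarrow> g w (u + v) = g w u + g w v"
  using add_left sym by (metis closed_ops(2))

lemma scale_right: "\<lbrakk>u \<in> V; v \<in> V\<rbrakk> \<Longrightarrow> g u (r *\<^sub>R v) = r * g u v"
  using scale_left sym by (metis closed_ops(4))

lemma diff_left: "\<lbrakk>u \<in> V; v \<in> V; w \<in> V\<rbrakk> \<Longrightarrow> g (u - v) w = g u w - g v w"
  using add_left[of "u - v" v w] by simp

lemma diff_right: "\<lbrakk>u \<in> V; v \<in> V; w \<in> V\<rbrakk> \<Longrightarrow> g w (u - v) = g w u - g w v"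
  using add_right[of "u - v" v w] by simp

lemma zero_left [simp]: "u \<in> V \<Longrightarrow> g 0 u = 0"
  using diff_left[of 0 0 u] by simp

lemma nonneg: "u \<in> V \<Longrightarrow> 0 \<le> g u u"
  using pos[of u] by (cases "u = 0") auto

lemma cauchy_schwarz:
  assumes "u \<in> V" "v \<in> V"
  shows "(g u v)\<^sup>2 \<le> g u u * g v v"
proof (rule quadratic_nonneg_imp)
  fix t
  have "0 \<le> g (t *\<^sub>R u + v) (t *\<^sub>R u + v)"
    using assms by (intro nonneg) auto
  also have "\<dots> = g u u * t\<^sup>2 + 2 * g u v * t + g v v"
    using assms sym[of u v]
    by (simp add: add_left add_right scale_left scale_right algebra_simps power2_eq_square)
  finally show "0 \<le> g u u * t\<^sup>2 + 2 * g u v * t + g v v" .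
qed (use assms nonneg in auto)

lemma eq_if_all_eq:
  assumes "u \<in> V" "w \<in> V" "\<And>v. v \<in> V \<Longrightarrow> g u v = g w v"
  shows "u = w"
proof (rule ccontr)
  assume "u \<noteq> w"
  then have "0 < g (u - w) (u - w)" using assms by (intro pos) auto
  then show False using assms by (simp add: diff_left)
qed

text \<open>The representing vector minimizes the energy \<open>g v v - 2 * f v\<close>. By the
  parallelogram identity a minimizing sequence is Cauchy, and the variation in direction
  \<open>v\<close> shows that its limit represents \<open>f\<close>.\<close>

theorem riesz:
  assumes f_add: "\<And>u v. \<lbrakk>u \<in> V; v \<in> V\<rbrakk> \<Longrightarrow> f (u + v) = f u + f v"
    and f_scale: "\<And>r u. u \<in> V \<Longrightarrow> f (r *\<^sub>R u) = r * f u"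
    and f_bound: "\<And>v. v \<in> V \<Longrightarrow> (f v)\<^sup>2 \<le> K * g v v" and "0 \<le> K"
  shows "\<exists>u\<in>V. \<forall>v\<in>V. g u v = f v"
proof -
  define E where "E v = g v v - 2 * f v" for v
  have E_ge: "- K \<le> E v" if "v \<in> V" for v
  proof -
    \<comment> \<open>The inequality of arithmetic and geometric means, applied to \<open>K\<close>
      and \<open>g v v\<close>, bounds the energy from below by \<open>- K\<close>.\<close>
    have "(2 * f v)\<^sup>2 \<le> 4 * (K * g v v)" using f_bound[OF that] by (simp add: power_mult_distrib)
    also have "\<dots> \<le> (K + g v v)\<^sup>2"
      using zero_le_power2[of "K - g v v"] by (simp add: power2_eq_square algebra_simps)
    finally have "2 * f v \<le> K + g v v"
      using nonneg[OF that] \<open>0 \<le> K\<close> by (rule power2_le_imp_le[OF _ add_nonneg_nonneg[rotated]])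
    then show ?thesis by (simp add: E_def)
  qed
  define m where "m = Inf (E ` V)"
  have bdd: "bdd_below (E ` V)" using E_ge by (auto simp: bdd_below_def)
  have m_le: "m \<le> E v" if "v \<in> V" for v
    unfolding m_def using bdd that by (intro cInf_lower) auto
  have "\<exists>v\<in>V. E v < m + 1 / real (Suc n)" for n
  proof -
    have "Inf (E ` V) < m + 1 / real (Suc n)" by (simp add: m_def)
    then show ?thesis using cInf_lessD[of "E ` V"] closed_ops(1) by blast
  qed
  then obtain s where s: "\<And>n. s n \<in> V" "\<And>n. E (s n) < m + 1 / real (Suc n)"
    by metis
  have parallelogram: "g (u - v) (u - v) \<le> 2 * (E u - m) + 2 * (E v - m)"
    if "u \<in> V" "v \<in> V" for u v
  proof -
    have "g (u - v) (u - v) = 2 * E u + 2 * E v - 4 * E ((1/2) *\<^sub>R (u + v))"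
      using that sym[of u v]
      by (simp add: E_def add_left add_right scale_left scale_right diff_left diff_right f_add
          f_scale algebra_simps)
    moreover have "m \<le> E ((1/2) *\<^sub>R (u + v))" using that by (intro m_le) auto
    ultimately show ?thesis by simp
  qed
  have "\<exists>N. \<forall>k\<ge>N. \<forall>n\<ge>N. g (s n - s k) (s n - s k) < e" if "e > 0" for e
  proof -
    obtain N where N: "1 / real (Suc N) < e / 4"
      using \<open>e > 0\<close> nat_approx_posE[of "e / 4"] by auto
    have "g (s n - s k) (s n - s k) < e" if "k \<ge> N" "n \<ge> N" for k n
    proof -
      have "1 / real (Suc k) \<le> 1 / real (Suc N)" "1 / real (Suc n) \<le> 1 / real (Suc N)"
        using that by (auto simp: field_simps)
      then show ?thesis using parallelogram[of "s n" "s k"] s[of n] s[of k] N by auto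
    qed
    then show ?thesis by blast
  qed
  then obtain l where l: "l \<in> V" "(\<lambda>n. g (s n - l) (s n - l)) \<longlonglongrightarrow> 0"
    using complete[of s] s by blast
  have "g l v = f v" if "v \<in> V" for v
  proof -
    \<comment> \<open>The energy of \<open>s n\<close> exceeds the infimum by less than
      \<open>1 / Suc n\<close>, so the quadratic polynomial
      \<open>t \<mapsto> E (s n + t *\<^sub>R v) - m\<close> is nonnegative with a small constant
      term. Its discriminant then bounds the linear coefficient.\<close>
    have "(g (s n) v - f v)\<^sup>2 \<le> g v v * (1 / real (Suc n))" for n
    proof (rule quadratic_nonneg_imp)
      fix t
      have "m \<le> E (s n + t *\<^sub>R v)" using s that by (intro m_le) auto
      also have "\<dots> = g v v * t\<^sup>2 + 2 * (g (s n) v - f v) * t + E (s n)"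
        using s that sym[of "s n" v]
        by (simp add: E_def add_left add_right scale_left scale_right f_add f_scale algebra_simps
            power2_eq_square)
      finally show "0 \<le> g v v * t\<^sup>2 + 2 * (g (s n) v - f v) * t + 1 / real (Suc n)"
        using s(2)[of n] by simp
    qed (use that nonneg in auto)
    moreover have "(\<lambda>n. g v v * (1 / real (Suc n))) \<longlonglongrightarrow> 0"
      using tendsto_mult_right_zero[OF LIMSEQ_inverse_real_of_nat] by (simp add: inverse_eq_divide)
    ultimately have 1: "(\<lambda>n. g (s n) v - f v) \<longlonglongrightarrow> 0"
      by (intro tendsto_0_if_square_le[where x = "\<lambda>n. g (s n) v - f v"]) auto
    have "(\<lambda>n. g (s n - l) v) \<longlonglongrightarrow> 0"
    proof (rule tendsto_0_if_square_le)
      show "(norm (g (s n - l) v))\<^sup>2 \<le> g (s n - l) (s n - l) * g v v" for n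
        using cauchy_schwarz[of "s n - l" v] s l that by auto
      show "(\<lambda>n. g (s n - l) (s n - l) * g v v) \<longlonglongrightarrow> 0"
        using tendsto_mult_left_zero[OF l(2)] .
    qed
    then have "(\<lambda>n. g (s n) v - g l v) \<longlonglongrightarrow> 0"
      using s l that by (simp add: diff_left)
    from tendsto_diff[OF 1 this] have "(\<lambda>n::nat. g l v - f v) \<longlonglongrightarrow> 0" by simp
    then show ?thesis by (simp add: LIMSEQ_const_iff)
  qed
  then show ?thesis using l by blast
qed

text \<open>Let \<open>A\<close> and \<open>F\<close> represent \<open>a\<close> and \<open>f\<close> with respect to \<open>g\<close>. The Riesz theorem for the equivalent inner
  product \<open>g (A u) (A v)\<close> yields a \<open>u\<close> with \<open>A u - F\<close> orthogonal to the range of \<open>A\<close>, and such a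
  vector vanishes by coercivity.\<close>

theorem lax_milgram:
  assumes a_add_left: "\<And>u v w. \<lbrakk>u \<in> V; v \<in> V; w \<in> V\<rbrakk> \<Longrightarrow> a (u + v) w = a u w + a v w"
    and a_scale_left: "\<And>r u v. \<lbrakk>u \<in> V; v \<in> V\<rbrakk> \<Longrightarrow> a (r *\<^sub>R u) v = r * a u v"
    and a_add_right: "\<And>u v w. \<lbrakk>u \<in> V; v \<in> V; w \<in> V\<rbrakk> \<Longrightarrow> a w (u + v) = a w u + a w v"
    and a_scale_right: "\<And>r u v. \<lbrakk>u \<in> V; v \<in> V\<rbrakk> \<Longrightarrow> a u (r *\<^sub>R v) = r * a u v"
    and a_bound: "\<And>u v. \<lbrakk>u \<in> V; v \<in> V\<rbrakk> \<Longrightarrow> (a u v)\<^sup>2 \<le> C * g u u * g v v" and "0 \<le> C"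
    and coercive: "\<And>u. u \<in> V \<Longrightarrow> c * g u u \<le> a u u" and "0 < c"
    and f_add: "\<And>u v. \<lbrakk>u \<in> V; v \<in> V\<rbrakk> \<Longrightarrow> f (u + v) = f u + f v"
    and f_scale: "\<And>r u. u \<in> V \<Longrightarrow> f (r *\<^sub>R u) = r * f u"
    and f_bound: "\<And>v. v \<in> V \<Longrightarrow> (f v)\<^sup>2 \<le> K * g v v" and "0 \<le> K"
  shows "\<exists>u\<in>V. \<forall>v\<in>V. a u v = f v"
proof -
  obtain F where F: "F \<in> V" "\<And>v. v \<in> V \<Longrightarrow> g F v = f v"
    using riesz[OF f_add f_scale f_bound \<open>0 \<le> K\<close>] by blast
  have "\<exists>w\<in>V. \<forall>v\<in>V. g w v = a u v" if "u \<in> V" for u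
    using that \<open>0 \<le> C\<close> nonneg[of u]
    by (intro riesz[where K = "C * g u u"] a_add_right a_scale_right a_bound) auto
  then obtain A where A: "\<And>u. u \<in> V \<Longrightarrow> A u \<in> V" "\<And>u v. \<lbrakk>u \<in> V; v \<in> V\<rbrakk> \<Longrightarrow> g (A u) v = a u v"
    by metis
  have A_add: "A (u + v) = A u + A v" if "u \<in> V" "v \<in> V" for u v
    using that A by (intro eq_if_all_eq) (auto simp: add_left a_add_left)
  have A_scale: "A (r *\<^sub>R u) = r *\<^sub>R A u" if "u \<in> V" for r u
    using that A by (intro eq_if_all_eq) (auto simp: scale_left a_scale_left)
  have A_le: "g (A u) (A u) \<le> C * g u u" if "u \<in> V" for u
  proof (cases "g (A u) (A u) = 0")
    case True
    then show ?thesis using \<open>0 \<le> C\<close> nonneg that by auto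
  next
    case False
    then have "0 < g (A u) (A u)" using nonneg[of "A u"] A(1)[OF that] by simp
    moreover have "(g (A u) (A u))\<^sup>2 \<le> C * g u u * g (A u) (A u)"
      using a_bound[of u "A u"] A that by simp
    ultimately show ?thesis by (simp add: power2_eq_square)
  qed
  \<comment> \<open>Together with \<open>A_le\<close> this makes \<open>g (A u) (A v)\<close>
    equivalent to \<open>g\<close>: the lower bound gives definiteness and transfers Cauchy
    sequences, the upper bound transfers convergence.\<close>
  have A_ge: "c\<^sup>2 * g u u \<le> g (A u) (A u)" if "u \<in> V" for u
  proof (cases "u = 0")
    case True
    then show ?thesis using that A nonneg[of "A 0"] by simp
  next
    case False
    then have u: "0 < g u u" using pos that by simp
    have "(c * g u u)\<^sup>2 \<le> (g (A u) u)\<^sup>2"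
      using coercive[OF that] \<open>0 < c\<close> u A that by (intro power_mono) auto
    also have "\<dots> \<le> g (A u) (A u) * g u u" using A that by (intro cauchy_schwarz) auto
    finally show ?thesis using u by (simp add: power2_eq_square)
  qed
  have A_diff: "A (u - v) = A u - A v" if "u \<in> V" "v \<in> V" for u v
    using A_add[of "u - v" v] that by (simp add: algebra_simps)
  interpret A: hilbert_form V "\<lambda>u v. g (A u) (A v)"
  proof
    show "subspace V" by (fact subspace)
    show "0 < g (A u) (A u)" if "u \<in> V" "u \<noteq> 0" for u
      using A_ge[OF that(1)] pos[OF that] \<open>0 < c\<close>
      by (meson less_le_trans mult_pos_pos zero_less_power)
    show "\<exists>l\<in>V. (\<lambda>n. g (A (s n - l)) (A (s n - l))) \<longlonglongrightarrow> 0"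
      if s: "\<And>n. s n \<in> V"
        and cauchy: "\<And>e. e > 0 \<Longrightarrow> \<exists>N. \<forall>m\<ge>N. \<forall>n\<ge>N. g (A (s n - s m)) (A (s n - s m)) < e" for s
    proof -
      have "\<exists>N. \<forall>m\<ge>N. \<forall>n\<ge>N. g (s n - s m) (s n - s m) < e" if "e > 0" for e
      proof -
        obtain N where N: "\<forall>m\<ge>N. \<forall>n\<ge>N. g (A (s n - s m)) (A (s n - s m)) < c\<^sup>2 * e"
          using cauchy[of "c\<^sup>2 * e"] \<open>0 < c\<close> \<open>e > 0\<close> by auto
        have "g (s n - s m) (s n - s m) < e" if "m \<ge> N" "n \<ge> N" for m n
        proof -
          have "c\<^sup>2 * g (s n - s m) (s n - s m) < c\<^sup>2 * e"
            using A_ge[of "s n - s m"] s N that by (meson closed_ops(3) le_less_trans)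
          then show ?thesis using \<open>0 < c\<close> by simp
        qed
        then show ?thesis by blast
      qed
      then obtain l where l: "l \<in> V" "(\<lambda>n. g (s n - l) (s n - l)) \<longlonglongrightarrow> 0"
        using complete[of s] s by blast
      have "(\<lambda>n. g (A (s n - l)) (A (s n - l))) \<longlonglongrightarrow> 0"
      proof (rule tendsto_sandwich)
        show "\<forall>\<^sub>F n in sequentially. 0 \<le> g (A (s n - l)) (A (s n - l))"
          using s l A by (intro always_eventually allI nonneg) auto
        show "\<forall>\<^sub>F n in sequentially. g (A (s n - l)) (A (s n - l)) \<le> C * g (s n - l) (s n - l)"
          using s l by (intro always_eventually allI A_le) auto
        show "(\<lambda>n. C * g (s n - l) (s n - l)) \<longlonglongrightarrow> 0"
          using tendsto_mult_right_zero[OF l(2)] .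
      qed auto
      then show ?thesis using l by blast
    qed
    show "g (A u) (A v) = g (A v) (A u)" if "u \<in> V" "v \<in> V" for u v
      using A(1) that by (intro sym)
  qed (simp_all add: A(1) A_add A_scale add_left scale_left)
  have "\<exists>u\<in>V. \<forall>v\<in>V. g (A u) (A v) = g F (A v)"
  proof (rule A.riesz[where K = "g F F"])
    show "(g F (A v))\<^sup>2 \<le> g F F * g (A v) (A v)" if "v \<in> V" for v
      using that A F by (intro cauchy_schwarz) auto
    show "0 \<le> g F F" by (rule nonneg[OF F(1)])
  qed (use A(1) F(1) in \<open>simp_all add: A_add A_scale add_right scale_right\<close>)
  then obtain u where u: "u \<in> V" "\<And>v. v \<in> V \<Longrightarrow> g (A u) (A v) = g F (A v)"
    by blast
  define w where "w = A u - F"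
  have w: "w \<in> V" using u A F by (auto simp: w_def)
  have "a w w = g (A w) w" using w A by simp
  also have "\<dots> = g w (A w)" using w A by (intro sym) auto
  also have "\<dots> = 0" using u(2)[OF w] u(1) w A F by (simp add: w_def diff_left)
  finally have "c * g w w \<le> 0" using coercive[OF w] by simp
  then have "w = 0" using pos[OF w] \<open>0 < c\<close> by (metis mult_pos_pos not_less)
  then have "A u = F" by (simp add: w_def)
  then show ?thesis using u(1) A F by metis
qed

end

section \<open>Complex inner product spaces\<close>

lemma cinner_add_right: "cinner x (y + z) = cinner x y + cinner x z"
  by (metis cinner_add_left cinner_commute complex_cnj_add)

lemma cinner_scaleC_right: "cinner x (a *\<^sub>C y) = cnj a * cinner x y"
  by (metis cinner_scaleC_left cinner_commute complex_cnj_mult)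

lemma cinner_self: "cinner x x = complex_of_real ((norm x)\<^sup>2)"
proof -
  have "Im (cinner x x) = 0" using cinner_commute[of x x] by (simp add: complex_eq_iff)
  then show ?thesis by (simp add: complex_eq_iff power2_norm_eq_inner inner_eq_Re_cinner)
qed

lemma norm_scaleC:
  fixes x :: "'a::complex_inner"
  shows "norm (a *\<^sub>C x) = cmod a * norm x"
proof -
  have "complex_of_real ((norm (a *\<^sub>C x))\<^sup>2) = a * cnj a * cinner x x"
    by (simp only: cinner_self[symmetric] cinner_scaleC_left cinner_scaleC_right mult.assoc
        mult.left_commute)
  also have "\<dots> = complex_of_real ((cmod a * norm x)\<^sup>2)"
    by (simp only: cinner_self complex_norm_square[symmetric] power_mult_distrib of_real_mult)
  finally show ?thesis
    by (simp only: of_real_eq_iff) (rule power2_eq_imp_eq, auto)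
qed

text \<open>Multiplying \<open>x\<close> by a unimodular scalar makes the inner product a
  nonnegative real, hence equal to its real part, to which the real Cauchy--Schwarz inequality
  applies.\<close>

lemma cmod_cinner_le: "cmod (cinner x y) \<le> norm x * norm y"
proof (cases "cinner x y = 0")
  case False
  define c where "c = cnj (sgn (cinner x y))"
  have c: "cmod c = 1" using False by (simp add: c_def norm_sgn)
  have "c * cinner x y = complex_of_real (cmod (cinner x y))"
    using False
    by (simp add: c_def sgn_div_norm scaleR_conv_of_real complex_norm_square field_simps
        power2_eq_square flip: complex_norm_square)
  then have "cmod (cinner x y) = inner (c *\<^sub>C x) y"
    by (simp add: inner_eq_Re_cinner cinner_scaleC_left)
  also have "\<dots> \<le> norm (c *\<^sub>C x) * norm y" by (rule norm_cauchy_schwarz)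
  finally show ?thesis using c by (simp add: norm_scaleC)
qed simp

interpretation cinner: bounded_bilinear cinner
proof
  show "\<exists>K. \<forall>x y :: 'a. cmod (cinner x y) \<le> norm x * norm y * K"
    using cmod_cinner_le by (intro exI[of _ 1]) (simp, blast)
qed (auto simp: cinner_add_left cinner_add_right scaleR_scaleC cinner_scaleC_left
    cinner_scaleC_right scaleC_complex_def)

declare cinner.zero_left [simp] cinner.zero_right [simp]

lemma tendsto_scaleC:
  fixes s :: "nat \<Rightarrow> 'a::complex_inner"
  assumes "s \<longlonglongrightarrow> x"
  shows "(\<lambda>n. a *\<^sub>C s n) \<longlonglongrightarrow> a *\<^sub>C x"
proof -
  have "bounded_linear (\<lambda>x :: 'a. a *\<^sub>C x)"
    by (rule bounded_linear_intro[where K = "cmod a"])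
      (simp_all add: scaleC_add_right scaleR_scaleC scaleC_scaleC norm_scaleC mult.commute)
  then show ?thesis using assms by (rule bounded_linear.tendsto)
qed

text \<open>Relations are subspaces of this product, so membership in an adjoint becomes
  orthogonality to a graph, and pairs can be projected onto closed graphs.\<close>

instantiation prod :: (complex_inner, complex_inner) complex_inner
begin

definition cinner_prod :: "'a \<times> 'b \<Rightarrow> 'a \<times> 'b \<Rightarrow> complex" where
  "cinner_prod x y = cinner (fst x) (fst y) + cinner (snd x) (snd y)"

instance
proof
  fix x y z :: "'a \<times> 'b" and a :: complex
  show "cinner x y = cnj (cinner y x)"
    unfolding cinner_prod_def complex_cnj_add by (simp only: cinner_commute[symmetric])
qed (simp_all add: cinner_prod_def cinner_add_left cinner_scaleC_left scaleC_prod_def inner_prod_def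
    inner_eq_Re_cinner algebra_simps)

end

instance prod :: (chilbert_space, chilbert_space) chilbert_space ..

lemma csubspace_imp_subspace: "csubspace V \<Longrightarrow> subspace V"
  by (auto simp: complex_vector.subspace_def subspace_def scaleR_scaleC)

lemma csubspace_closure:
  fixes V :: "'a::complex_inner set"
  assumes "csubspace V"
  shows "csubspace (closure V)"
proof (rule complex_vector.subspaceI)
  show "0 \<in> closure V" using complex_vector.subspace_0[OF assms] closure_subset by blast
next
  fix x y assume "x \<in> closure V" "y \<in> closure V"
  then obtain s t where "\<And>n. s n \<in> V" "s \<longlonglongrightarrow> x" "\<And>n. t n \<in> V" "t \<longlonglongrightarrow> y"
    unfolding closure_sequential by blast
  then show "x + y \<in> closure V"
    unfolding closure_sequential
    by (intro exI[of _ "\<lambda>n. s n + t n"])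
      (auto intro: tendsto_add complex_vector.subspace_add[OF assms])
next
  fix x c assume "x \<in> closure V"
  then obtain s where "\<And>n. s n \<in> V" "s \<longlonglongrightarrow> x"
    unfolding closure_sequential by blast
  then show "c *\<^sub>C x \<in> closure V"
    unfolding closure_sequential
    by (intro exI[of _ "\<lambda>n. c *\<^sub>C s n"])
      (auto intro: tendsto_scaleC complex_vector.subspace_scale[OF assms])
qed

lemma csubspace_Domain:
  assumes "csubspace R"
  shows "csubspace (Domain R)"
proof (rule complex_vector.subspaceI)
  show "0 \<in> Domain R"
    using complex_vector.subspace_0[OF assms] by (auto simp: zero_prod_def)
  show "x + y \<in> Domain R" if "x \<in> Domain R" "y \<in> Domain R" for x y
    using that complex_vector.subspace_add[OF assms] by (fastforce elim!: DomainE)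
  show "c *\<^sub>C x \<in> Domain R" if "x \<in> Domain R" for c x
    using that complex_vector.subspace_scale[OF assms, of _ c]
    by (fastforce simp: scaleC_prod_def elim!: DomainE)
qed

lemma csubspace_pair:
  assumes "csubspace R"
  shows csubspace_pair_0: "(0, 0) \<in> R"
    and csubspace_pair_add: "\<lbrakk>(x, y) \<in> R; (x', y') \<in> R\<rbrakk> \<Longrightarrow> (x + x', y + y') \<in> R"
    and csubspace_pair_diff: "\<lbrakk>(x, y) \<in> R; (x', y') \<in> R\<rbrakk> \<Longrightarrow> (x - x', y - y') \<in> R"
    and csubspace_pair_scale: "(x, y) \<in> R \<Longrightarrow> (a *\<^sub>C x, a *\<^sub>C y) \<in> R"
  using complex_vector.subspace_0[OF assms]
    complex_vector.subspace_add[OF assms, of "(x, y)" "(x', y')"]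
    complex_vector.subspace_diff[OF assms, of "(x, y)" "(x', y')"]
    complex_vector.subspace_scale[OF assms, of "(x, y)" a]
  by (simp_all add: zero_prod_def scaleC_prod_def)

lemma single_valued_if_csubspace:
  assumes "csubspace R" "\<And>y. (0, y) \<in> R \<Longrightarrow> y = 0"
  shows "single_valued R"
proof (rule single_valuedI)
  fix x y z assume "(x, y) \<in> R" "(x, z) \<in> R"
  from csubspace_pair_diff[OF assms(1) this] have "y - z = 0" by (intro assms(2)) simp
  then show "y = z" by simp
qed

text \<open>The real theorem matches the real parts of \<open>b u\<close> and \<open>f\<close>. Both
  are antilinear in \<open>v\<close>, so testing with \<open>\<i> *\<^sub>C v\<close> matches the
  imaginary parts.\<close>

lemma complex_lax_milgram:
  fixes V :: "'a::complex_vector set"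
  assumes "hilbert_form V g" and V: "csubspace V"
    and b_add_left: "\<And>u v w. \<lbrakk>u \<in> V; v \<in> V; w \<in> V\<rbrakk> \<Longrightarrow> b (u + v) w = b u w + b v w"
    and b_scale_left: "\<And>r u v. \<lbrakk>u \<in> V; v \<in> V\<rbrakk> \<Longrightarrow> b (r *\<^sub>R u) v = complex_of_real r * b u v"
    and b_add_right: "\<And>u v w. \<lbrakk>u \<in> V; v \<in> V; w \<in> V\<rbrakk> \<Longrightarrow> b w (u + v) = b w u + b w v"
    and b_scale_right: "\<And>a u v. \<lbrakk>u \<in> V; v \<in> V\<rbrakk> \<Longrightarrow> b u (a *\<^sub>C v) = cnj a * b u v"
    and b_bound: "\<And>u v. \<lbrakk>u \<in> V; v \<in> V\<rbrakk> \<Longrightarrow> (cmod (b u v))\<^sup>2 \<le> C * g u u * g v v" and "0 \<le> C"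
    and coercive: "\<And>u. u \<in> V \<Longrightarrow> c * g u u \<le> Re (b u u)" and "0 < c"
    and f_add: "\<And>u v. \<lbrakk>u \<in> V; v \<in> V\<rbrakk> \<Longrightarrow> f (u + v) = f u + f v"
    and f_scale: "\<And>a u. u \<in> V \<Longrightarrow> f (a *\<^sub>C u) = cnj a * f u"
    and f_bound: "\<And>v. v \<in> V \<Longrightarrow> (cmod (f v))\<^sup>2 \<le> K * g v v" and "0 \<le> K"
  shows "\<exists>u\<in>V. \<forall>v\<in>V. b u v = f v"
proof -
  interpret hilbert_form V g by fact
  have Re_sq_le: "(Re z)\<^sup>2 \<le> (cmod z)\<^sup>2" for z
    by (simp add: cmod_power2)
  have b_scaleR_right: "b u (r *\<^sub>R v) = complex_of_real r * b u v" if "u \<in> V" "v \<in> V" for r u v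
    using that by (simp add: scaleR_scaleC b_scale_right)
  have f_scaleR: "f (r *\<^sub>R v) = complex_of_real r * f v" if "v \<in> V" for r v
    using that by (simp add: scaleR_scaleC f_scale)
  have "\<exists>u\<in>V. \<forall>v\<in>V. Re (b u v) = Re (f v)"
  proof (rule lax_milgram[where C = C and c = c and K = K])
    show "(Re (b u v))\<^sup>2 \<le> C * g u u * g v v" if "u \<in> V" "v \<in> V" for u v
      using Re_sq_le b_bound[OF that] by (rule order_trans)
    show "(Re (f v))\<^sup>2 \<le> K * g v v" if "v \<in> V" for v
      using Re_sq_le f_bound[OF that] by (rule order_trans)
  qed (simp_all add: \<open>0 \<le> C\<close> \<open>0 < c\<close> \<open>0 \<le> K\<close> coercive b_add_left b_add_right f_add b_scale_left
      b_scaleR_right f_scaleR)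
  then obtain u where u: "u \<in> V" "\<And>v. v \<in> V \<Longrightarrow> Re (b u v) = Re (f v)" by blast
  have "b u v = f v" if "v \<in> V" for v
    using u(2)[OF that] u(2)[OF complex_vector.subspace_scale[OF V that, of \<i>]] u(1) that
    by (simp add: complex_eq_iff b_scale_right f_scale)
  then show ?thesis using u(1) by blast
qed

lemma hilbert_form_inner:
  fixes M :: "'a::{real_inner, complete_space} set"
  assumes "subspace M" "closed M"
  shows "hilbert_form M inner"
proof
  show "\<exists>l\<in>M. (\<lambda>n. inner (s n - l) (s n - l)) \<longlonglongrightarrow> 0"
    if s: "\<And>n. s n \<in> M"
      and cauchy: "\<And>e. e > 0 \<Longrightarrow> \<exists>N. \<forall>m\<ge>N. \<forall>n\<ge>N. inner (s n - s m) (s n - s m) < e" for s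
  proof -
    have "Cauchy s"
    proof (rule CauchyI)
      fix e :: real assume "e > 0"
      then obtain N where "\<forall>m\<ge>N. \<forall>n\<ge>N. inner (s n - s m) (s n - s m) < e\<^sup>2"
        using cauchy[of "e\<^sup>2"] by auto
      then have "\<forall>m\<ge>N. \<forall>n\<ge>N. norm (s n - s m) < e"
        using \<open>e > 0\<close> by (auto simp: power2_norm_eq_inner[symmetric] intro: power2_less_imp_less)
      then show "\<exists>N. \<forall>m\<ge>N. \<forall>n\<ge>N. norm (s m - s n) < e" by blast
    qed
    then obtain l where l: "s \<longlonglongrightarrow> l" using convergent_eq_Cauchy by blast
    then have "(\<lambda>n. inner (s n - l) (s n - l)) \<longlonglongrightarrow> inner (l - l) (l - l)"
      by (intro tendsto_intros)
    moreover have "l \<in> M" using closed_sequentially[OF assms(2) _ l] s by blast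
    ultimately show ?thesis by auto
  qed
qed (use assms in \<open>auto simp: inner_add_left intro: inner_commute\<close>)

lemma cmod_cinner_square_le:
  fixes x y :: "'a::complex_inner"
  shows "(cmod (cinner x y))\<^sup>2 \<le> (norm x)\<^sup>2 * inner y y"
  using power_mono[OF cmod_cinner_le[of x y], of 2]
  by (simp add: power_mult_distrib power2_norm_eq_inner)

lemma csubspace_cinner_eqI:
  assumes "csubspace M" "x \<in> M" "y \<in> M" "\<And>z. z \<in> M \<Longrightarrow> cinner x z = cinner y z"
  shows "x = y"
proof -
  have "cinner (x - y) (x - y) = 0"
    using assms by (simp add: cinner.diff_left complex_vector.subspace_diff)
  then show ?thesis by (simp add: cinner_self)
qed

lemma cinner_0_if_orth_closure:
  assumes "\<And>z. z \<in> X \<Longrightarrow> cinner x z = 0" "y \<in> closure X"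
  shows "cinner x y = 0"
proof -
  obtain s where "\<And>n. s n \<in> X" "s \<longlonglongrightarrow> y" using assms(2) unfolding closure_sequential by blast
  with cinner.tendsto[OF tendsto_const[of x] this(2)] assms(1) show ?thesis
    by (simp add: LIMSEQ_const_iff)
qed

text \<open>The projection is the vector of \<open>M\<close> that represents the functional
  \<open>cinner x\<close> restricted to \<open>M\<close>. Lax--Milgram supplies it, with the inner
  product itself as the coercive form.\<close>

lemma projection_exists:
  fixes M :: "'a::chilbert_space set"
  assumes "csubspace M" "closed M"
  shows "\<exists>p\<in>M. \<forall>z\<in>M. cinner (x - p) z = 0"
proof -
  have "\<exists>p\<in>M. \<forall>z\<in>M. cinner p z = cinner x z"
  proof (rule complex_lax_milgram[where g = inner and C = 1 and c = 1 and K = "(norm x)\<^sup>2"])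
    show "(cmod (cinner u v))\<^sup>2 \<le> 1 * inner u u * inner v v" for u v :: 'a
      using cmod_cinner_square_le[of u v] by (simp add: power2_norm_eq_inner[of u])
    show "(cmod (cinner x v))\<^sup>2 \<le> (norm x)\<^sup>2 * inner v v" for v
      by (rule cmod_cinner_square_le)
  qed (use assms in \<open>auto intro: hilbert_form_inner csubspace_imp_subspace
      simp: cinner_add_left cinner_add_right cinner_scaleC_right cinner_scaleC_left scaleR_scaleC
      inner_eq_Re_cinner\<close>)
  then show ?thesis unfolding cinner.diff_left right_minus_eq by metis
qed

lemma
  fixes M :: "'a::chilbert_space set"
  assumes "csubspace M" "closed M"
  shows orth_proj_in: "orth_proj M x \<in> M"
    and cinner_orth_proj_left: "z \<in> M \<Longrightarrow> cinner (orth_proj M x) z = cinner x z"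
proof -
  have "\<exists>!p. p \<in> M \<and> (\<forall>z\<in>M. cinner (x - p) z = 0)"
  proof (rule ex_ex1I)
    show "\<exists>p. p \<in> M \<and> (\<forall>z\<in>M. cinner (x - p) z = 0)"
      using projection_exists[OF assms] by blast
    fix p q
    assume p: "p \<in> M \<and> (\<forall>z\<in>M. cinner (x - p) z = 0)" and q: "q \<in> M \<and> (\<forall>z\<in>M. cinner (x - q) z = 0)"
    then show "p = q"
      using assms(1) by (intro csubspace_cinner_eqI[of M]) (auto simp: cinner.diff_left)
  qed
  from theI'[OF this] have *: "orth_proj M x \<in> M \<and> (\<forall>z\<in>M. cinner (x - orth_proj M x) z = 0)"
    unfolding orth_proj_def .
  then show "orth_proj M x \<in> M" by blast
  show "cinner (orth_proj M x) z = cinner x z" if "z \<in> M"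
    using * that by (auto simp: cinner.diff_left)
qed

section \<open>Adjoints of linear relations\<close>

lemma rel_adjoint_iff:
  "(k, h) \<in> rel_adjoint X Y T \<longleftrightarrow>
    k \<in> Y \<and> h \<in> X \<and> (\<forall>f f'. (f, f') \<in> T \<longrightarrow> cinner k f' = cinner h f)"
  by (auto simp: rel_adjoint_def)

lemma converse_rel_adjoint: "(rel_adjoint X Y T)\<inverse> = rel_adjoint Y X (T\<inverse>)"
  by (auto simp: rel_adjoint_iff)

lemma csubspace_rel_adjoint:
  assumes "csubspace X" "csubspace Y"
  shows "csubspace (rel_adjoint X Y T)"
proof (rule complex_vector.subspaceI)
  show "0 \<in> rel_adjoint X Y T"
    using assms by (simp add: zero_prod_def rel_adjoint_iff complex_vector.subspace_0)
  fix x y c assume "x \<in> rel_adjoint X Y T"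
  then have x: "(fst x, snd x) \<in> rel_adjoint X Y T" by simp
  then have "(c *\<^sub>C fst x, c *\<^sub>C snd x) \<in> rel_adjoint X Y T"
    using assms unfolding rel_adjoint_iff
    by (simp add: complex_vector.subspace_scale cinner_scaleC_left)
  then show "c *\<^sub>C x \<in> rel_adjoint X Y T" by (simp add: scaleC_prod_def)
  assume "y \<in> rel_adjoint X Y T"
  then have "(fst y, snd y) \<in> rel_adjoint X Y T" by simp
  with x have "(fst x + fst y, snd x + snd y) \<in> rel_adjoint X Y T"
    using assms unfolding rel_adjoint_iff
    by (simp add: complex_vector.subspace_add cinner_add_left)
  then show "x + y \<in> rel_adjoint X Y T" by (simp add: plus_prod_def)
qed

lemma closed_rel_adjoint:
  assumes "closed X" "closed Y"
  shows "closed (rel_adjoint X Y T)"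
  unfolding closed_sequential_limits
proof (intro allI impI, elim conjE)
  fix s l assume s: "\<forall>n. s n \<in> rel_adjoint X Y T" and l: "s \<longlonglongrightarrow> l"
  have lim: "(\<lambda>n. fst (s n)) \<longlonglongrightarrow> fst l" "(\<lambda>n. snd (s n)) \<longlonglongrightarrow> snd l"
    using tendsto_fst[OF l] tendsto_snd[OF l] .
  have sn: "(fst (s n), snd (s n)) \<in> rel_adjoint X Y T" for n
    using s by simp
  then have "fst l \<in> Y" "snd l \<in> X"
    using closed_sequentially[OF assms(2) _ lim(1)] closed_sequentially[OF assms(1) _ lim(2)]
    unfolding rel_adjoint_iff by blast+
  moreover have "cinner (fst l) f' = cinner (snd l) f" if "(f, f') \<in> T" for f f'
  proof (rule LIMSEQ_unique)
    show "(\<lambda>n. cinner (fst (s n)) f') \<longlonglongrightarrow> cinner (fst l) f'"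
      by (intro cinner.tendsto lim tendsto_const)
    have "(\<lambda>n. cinner (snd (s n)) f) \<longlonglongrightarrow> cinner (snd l) f"
      by (intro cinner.tendsto lim tendsto_const)
    moreover have "cinner (fst (s n)) f' = cinner (snd (s n)) f" for n
      using sn[of n] that unfolding rel_adjoint_iff by blast
    ultimately show "(\<lambda>n. cinner (fst (s n)) f') \<longlonglongrightarrow> cinner (snd l) f"
      by simp
  qed
  ultimately have "(fst l, snd l) \<in> rel_adjoint X Y T"
    unfolding rel_adjoint_iff by blast
  then show "l \<in> rel_adjoint X Y T" by simp
qed

text \<open>The adjoint condition on \<open>(k, h)\<close> says that \<open>(h, - k)\<close> is
  orthogonal to the graph, and orthogonality passes to the closure.\<close>

lemma rel_adjoint_closure: "rel_adjoint X Y (closure T) = rel_adjoint X Y T"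
proof
  show "rel_adjoint X Y (closure T) \<subseteq> rel_adjoint X Y T"
    using closure_subset[of T] by (fastforce simp: rel_adjoint_iff)
  show "rel_adjoint X Y T \<subseteq> rel_adjoint X Y (closure T)"
  proof (rule subrelI)
    fix k h assume kh: "(k, h) \<in> rel_adjoint X Y T"
    have "cinner k f' = cinner h f" if "(f, f') \<in> closure T" for f f'
    proof -
      have "cinner (h, - k) (f, f') = 0"
      proof (rule cinner_0_if_orth_closure[OF _ that])
        show "cinner (h, - k) z = 0" if "z \<in> T" for z
          using kh that by (cases z) (auto simp: rel_adjoint_iff cinner_prod_def cinner.minus_left)
      qed
      then show ?thesis by (simp add: cinner_prod_def cinner.minus_left)
    qed
    then show "(k, h) \<in> rel_adjoint X Y (closure T)" using kh by (auto simp: rel_adjoint_iff)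
  qed
qed

text \<open>Project \<open>(x, y)\<close> onto the closure of \<open>T\<close> and call the result
  \<open>(p, q)\<close>. The remainder is orthogonal to \<open>T\<close>, which after the sign
  change \<open>(q - y, x - p)\<close> is membership in the adjoint. Pairing with
  \<open>(x, y)\<close> makes the remainder orthogonal to \<open>(x, y)\<close> as well, hence to
  itself. The subspaces \<open>X\<close> and \<open>Y\<close> contain the components of the
  remainder since they are closed.\<close>

lemma double_rel_adjoint:
  fixes T :: "('a::chilbert_space \<times> 'b::chilbert_space) set"
  assumes X: "csubspace X" "closed X" and Y: "csubspace Y" "closed Y"
    and T: "csubspace T" "T \<subseteq> X \<times> Y"
  shows "rel_adjoint Y X (rel_adjoint X Y T) = closure T"
proof
  have "T \<subseteq> rel_adjoint Y X (rel_adjoint X Y T)"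
  proof (rule subrelI)
    fix f f' assume f: "(f, f') \<in> T"
    have "cinner f h = cinner f' k" if "(k, h) \<in> rel_adjoint X Y T" for k h
    proof -
      have "cinner k f' = cinner h f" using that f by (simp add: rel_adjoint_iff)
      then show ?thesis using cinner_commute by metis
    qed
    then show "(f, f') \<in> rel_adjoint Y X (rel_adjoint X Y T)"
      using T(2) f by (auto simp: rel_adjoint_iff)
  qed
  then show "closure T \<subseteq> rel_adjoint Y X (rel_adjoint X Y T)"
    using X Y by (intro closure_minimal closed_rel_adjoint)
  show "rel_adjoint Y X (rel_adjoint X Y T) \<subseteq> closure T"
  proof (rule subrelI)
    fix x y assume xy: "(x, y) \<in> rel_adjoint Y X (rel_adjoint X Y T)"
    obtain p q where pq: "(p, q) \<in> closure T"
      and orth: "\<And>z. z \<in> closure T \<Longrightarrow> cinner ((x, y) - (p, q)) z = 0"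
      using projection_exists[OF csubspace_closure[OF T(1)] closed_closure, of "(x, y)"] by auto
    have "closure T \<subseteq> X \<times> Y" using T(2) X(2) Y(2) by (intro closure_minimal closed_Times)
    then have "p \<in> X" "q \<in> Y" using pq by auto
    moreover have "x \<in> X" "y \<in> Y" using xy by (auto simp: rel_adjoint_iff)
    ultimately have "x - p \<in> X" "q - y \<in> Y"
      using X Y by (auto simp: complex_vector.subspace_diff)
    moreover have "cinner (q - y) f' = cinner (x - p) f" if "(f, f') \<in> T" for f f'
      using orth[of "(f, f')"] that closure_subset[of T]
      by (auto simp: cinner_prod_def cinner.diff_left algebra_simps)
    ultimately have "(q - y, x - p) \<in> rel_adjoint X Y T"
      by (auto simp: rel_adjoint_iff)
    then have "cinner x (x - p) = cinner y (q - y)" using xy by (auto simp: rel_adjoint_iff)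
    moreover have "cinner (x - p) p + cinner (y - q) q = 0"
      using orth[OF pq] by (simp add: cinner_prod_def)
    then have "cnj (cinner (x - p) p + cinner (y - q) q) = 0" by simp
    then have "cinner p (x - p) + cinner q (y - q) = 0"
      unfolding complex_cnj_add cinner_commute[symmetric] .
    ultimately have "cinner ((x, y) - (p, q)) ((x, y) - (p, q)) = 0"
      by (simp add: cinner_prod_def cinner.diff_left cinner.diff_right algebra_simps)
    then have "(x, y) = (p, q)" by (simp add: cinner_self zero_prod_def)
    then show "(x, y) \<in> closure T" using pq by simp
  qed
qed

text \<open>The multivalued part of the adjoint is the orthogonal complement of
  \<open>Domain T\<close>. It contains what is left of any vector after projection onto the closure
  of the domain.\<close>

lemma single_valued_rel_adjoint_iff:
  fixes T :: "('a::chilbert_space \<times> 'b::chilbert_space) set"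
  assumes "csubspace T" "0 \<in> Y"
  shows "single_valued (rel_adjoint UNIV Y T) \<longleftrightarrow> closure (Domain T) = UNIV"
proof
  show "closure (Domain T) = UNIV" if sv: "single_valued (rel_adjoint UNIV Y T)"
  proof (intro set_eqI iffI UNIV_I)
    fix x :: 'a
    have "csubspace (Domain T)" using assms(1) by (rule csubspace_Domain)
    then obtain p where p: "p \<in> closure (Domain T)" "\<And>z. z \<in> closure (Domain T) \<Longrightarrow> cinner (x - p) z = 0"
      using projection_exists[OF csubspace_closure closed_closure] by metis
    have "cinner (x - p) f = 0" if "(f, f') \<in> T" for f f'
      using p(2) closure_subset[of "Domain T"] that by blast
    then have "(0, x - p) \<in> rel_adjoint UNIV Y T"
      using \<open>0 \<in> Y\<close> by (simp add: rel_adjoint_iff)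
    moreover have "(0, 0) \<in> rel_adjoint UNIV Y T" using \<open>0 \<in> Y\<close> by (simp add: rel_adjoint_iff)
    ultimately have "x - p = 0" using sv by (blast dest: single_valuedD)
    then have "x = p" by simp
    then show "x \<in> closure (Domain T)" using p by simp
  qed
  show "single_valued (rel_adjoint UNIV Y T)" if dense: "closure (Domain T) = UNIV"
  proof (rule single_valuedI)
    fix k h h' assume kh: "(k, h) \<in> rel_adjoint UNIV Y T" "(k, h') \<in> rel_adjoint UNIV Y T"
    have "cinner (h - h') (h - h') = 0"
    proof (rule cinner_0_if_orth_closure)
      show "h - h' \<in> closure (Domain T)" using dense by simp
      show "cinner (h - h') z = 0" if "z \<in> Domain T" for z
        using kh that unfolding rel_adjoint_iff cinner.diff_left right_minus_eq
        by (metis DomainE)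
    qed
    then show "h = h'" by (simp add: cinner_self)
  qed
qed

section \<open>Closed sectorial forms\<close>

context hilbert_form
begin

lemma add_le: "\<lbrakk>u \<in> V; v \<in> V\<rbrakk> \<Longrightarrow> g (u + v) (u + v) \<le> 2 * g u u + 2 * g v v"
  using nonneg[of "u - v"] sym[of u v]
  by (simp add: add_left add_right diff_left diff_right)

text \<open>This is the closure of \<open>D\<close> for the norm of \<open>g\<close>, spelled out
  because \<open>g\<close> carries no topology of its own. The triangle inequality is replaced by
  \<open>add_le\<close>, whose factors 2 account for the \<open>e / 4\<close> below.\<close>

lemma closure_hilbert_form:
  assumes "subspace D" "D \<subseteq> V"
  shows "hilbert_form {w \<in> V. \<forall>e>0. \<exists>v\<in>D. g (v - w) (v - w) < e} g" (is "hilbert_form ?W g")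
proof
  show "subspace ?W"
    unfolding subspace_def
  proof (intro conjI ballI allI)
    show "0 \<in> ?W"
      using subspace_0[OF assms(1)] by (auto intro!: bexI[of _ 0])
    show "x + y \<in> ?W" if "x \<in> ?W" "y \<in> ?W" for x y
    proof -
      have "\<exists>v\<in>D. g (v - (x + y)) (v - (x + y)) < e" if "e > 0" for e
      proof -
        have "e / 4 > 0" using that by simp
        then obtain v w where vw: "v \<in> D" "g (v - x) (v - x) < e / 4" "w \<in> D" "g (w - y) (w - y) < e / 4"
          using \<open>x \<in> ?W\<close> \<open>y \<in> ?W\<close> by blast
        have "v - x \<in> V" "w - y \<in> V" using vw \<open>x \<in> ?W\<close> \<open>y \<in> ?W\<close> assms(2) by auto
        from add_le[OF this] have "g ((v - x) + (w - y)) ((v - x) + (w - y)) < e"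
          using vw by simp
        moreover have "(v - x) + (w - y) = (v + w) - (x + y)" by simp
        moreover have "v + w \<in> D" using vw subspace_add[OF assms(1)] by blast
        ultimately show ?thesis by metis
      qed
      then show ?thesis using that by auto
    qed
    show "r *\<^sub>R x \<in> ?W" if "x \<in> ?W" for r x
    proof -
      have "\<exists>v\<in>D. g (v - r *\<^sub>R x) (v - r *\<^sub>R x) < e" if "e > 0" for e
      proof -
        \<comment> \<open>The summand 1 covers \<open>r = 0\<close>.\<close>
        have "e / (r\<^sup>2 + 1) > 0" using that by (simp add: add_nonneg_pos)
        then obtain v where v: "v \<in> D" "g (v - x) (v - x) < e / (r\<^sup>2 + 1)"
          using \<open>x \<in> ?W\<close> by blast
        have V: "v - x \<in> V" using v \<open>x \<in> ?W\<close> assms(2) by auto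
        have "g (r *\<^sub>R (v - x)) (r *\<^sub>R (v - x)) = r\<^sup>2 * g (v - x) (v - x)"
          using V closed_ops(4)[OF V, of r] by (simp only: scale_left scale_right power2_eq_square mult.assoc)
        also have "\<dots> \<le> (r\<^sup>2 + 1) * g (v - x) (v - x)"
          using nonneg[OF V] by (intro mult_right_mono) auto
        also have "\<dots> < e"
          using v(2) by (simp add: pos_less_divide_eq add_nonneg_pos mult.commute)
        finally have "g (r *\<^sub>R v - r *\<^sub>R x) (r *\<^sub>R v - r *\<^sub>R x) < e"
          by (simp add: scaleR_diff_right)
        moreover have "r *\<^sub>R v \<in> D" using v subspace_scale[OF assms(1)] by blast
        ultimately show ?thesis by blast
      qed
      then show ?thesis using that by auto
    qed
  qed
  show "\<exists>l\<in>?W. (\<lambda>n. g (s n - l) (s n - l)) \<longlonglongrightarrow> 0"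
    if s: "\<And>n. s n \<in> ?W"
      and cauchy: "\<And>e. e > 0 \<Longrightarrow> \<exists>N. \<forall>m\<ge>N. \<forall>n\<ge>N. g (s n - s m) (s n - s m) < e" for s
  proof -
    have sV: "s n \<in> V" for n using s by blast
    obtain l where l: "l \<in> V" "(\<lambda>n. g (s n - l) (s n - l)) \<longlonglongrightarrow> 0"
      using complete[OF sV cauchy] by blast
    have "\<exists>v\<in>D. g (v - l) (v - l) < e" if "e > 0" for e
    proof -
      have e: "e / 4 > 0" using that by simp
      obtain n where n: "g (s n - l) (s n - l) < e / 4"
        using order_tendstoD(2)[OF l(2) e] by (auto simp: eventually_sequentially)
      obtain v where v: "v \<in> D" "g (v - s n) (v - s n) < e / 4" using s[of n] e by blast
      have "v - s n \<in> V" "s n - l \<in> V" using v sV[of n] l(1) assms(2) by auto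
      from add_le[OF this] have "g ((v - s n) + (s n - l)) ((v - s n) + (s n - l)) < e"
        using n v by simp
      then show ?thesis using v(1) by auto
    qed
    then show ?thesis using l by blast
  qed
qed (auto simp: add_left scale_left pos intro: sym)

end

section \<open>Estimates and continuity for sectorial forms\<close>

locale sectorial_form_on =
  fixes t :: "'a::complex_inner form"
  assumes sectorial: "sectorial_form t"
begin

lemma sesquilinear: "sesquilinear_form t"
  using sectorial by (simp add: sectorial_form_def)

lemma csubspace_dom: "csubspace (form_dom t)"
  using sesquilinear by (simp add: sesquilinear_form_def)

lemma dom_ops [simp, intro]:
  "0 \<in> form_dom t"
  "\<lbrakk>u \<in> form_dom t; v \<in> form_dom t\<rbrakk> \<Longrightarrow> u + v \<in> form_dom t"
  "\<lbrakk>u \<in> form_dom t; v \<in> form_dom t\<rbrakk> \<Longrightarrow> u - v \<in> form_dom t"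
  "u \<in> form_dom t \<Longrightarrow> c *\<^sub>C u \<in> form_dom t"
  using csubspace_dom
  by (auto simp: complex_vector.subspace_0 complex_vector.subspace_add complex_vector.subspace_diff
      complex_vector.subspace_scale)

lemma form_linear:
  assumes "u \<in> form_dom t" "v \<in> form_dom t" "w \<in> form_dom t"
  shows form_add_left: "form_val t (u + v) w = form_val t u w + form_val t v w"
    and form_add_right: "form_val t w (u + v) = form_val t w u + form_val t w v"
    and form_diff_left: "form_val t (u - v) w = form_val t u w - form_val t v w"
    and form_diff_right: "form_val t w (u - v) = form_val t w u - form_val t w v"
proof -
  have *: "form_val t (u + v) w = form_val t u w + form_val t v w"
    "form_val t w (u + v) = form_val t w u + form_val t w v"
    if "u \<in> form_dom t" "v \<in> form_dom t" "w \<in> form_dom t" for u v w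
    using sesquilinear that unfolding sesquilinear_form_def by blast+
  show "form_val t (u + v) w = form_val t u w + form_val t v w"
    "form_val t w (u + v) = form_val t w u + form_val t w v"
    using *[OF assms] .
  show "form_val t (u - v) w = form_val t u w - form_val t v w"
    "form_val t w (u - v) = form_val t w u - form_val t w v"
    using *[of "u - v" v w] assms by auto
qed

lemma form_scale:
  assumes "u \<in> form_dom t" "v \<in> form_dom t"
  shows form_scale_left: "form_val t (c *\<^sub>C u) v = c * form_val t u v"
    and form_scale_right: "form_val t u (c *\<^sub>C v) = cnj c * form_val t u v"
  using sesquilinear assms unfolding sesquilinear_form_def by blast+

lemma Re_nonneg: "u \<in> form_dom t \<Longrightarrow> 0 \<le> Re (form_val t u u)"
  using sectorial unfolding sectorial_form_def by blast

text \<open>The modulus is at most the sum of the absolute real and imaginary parts, so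
  \<open>K = 1 + tan \<alpha>\<close> works. Through this constant the sector enters the later
  estimates of moduli by real parts.\<close>

lemma cmod_diag_le: "\<exists>K\<ge>1. \<forall>u\<in>form_dom t. cmod (form_val t u u) \<le> K * Re (form_val t u u)"
proof -
  obtain \<alpha> where \<alpha>: "0 \<le> \<alpha>" "\<alpha> < pi / 2"
    and le: "\<And>u. u \<in> form_dom t \<Longrightarrow> 0 \<le> Re (form_val t u u)
      \<and> \<bar>Im (form_val t u u)\<bar> \<le> tan \<alpha> * Re (form_val t u u)"
    using sectorial unfolding sectorial_form_def by blast
  have "0 \<le> tan \<alpha>" using \<alpha> tan_gt_zero[of \<alpha>] by (cases "\<alpha> = 0") auto
  moreover have "cmod (form_val t u u) \<le> (1 + tan \<alpha>) * Re (form_val t u u)"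
    if "u \<in> form_dom t" for u
    using cmod_le[of "form_val t u u"] le[OF that] by (simp add: algebra_simps)
  ultimately show ?thesis by (intro exI[of _ "1 + tan \<alpha>"]) auto
qed

text \<open>By polarization, the Cauchy--Schwarz inequality up to a constant.\<close>

lemma cmod_le_Re:
  "\<exists>K\<ge>0. \<forall>u\<in>form_dom t. \<forall>v\<in>form_dom t.
    (cmod (form_val t u v))\<^sup>2 \<le> K * Re (form_val t u u) * Re (form_val t v v)"
proof -
  obtain K where K: "K \<ge> 1" "\<And>u. u \<in> form_dom t \<Longrightarrow> cmod (form_val t u u) \<le> K * Re (form_val t u u)"
    using cmod_diag_le by blast
  have le: "cmod (form_val t u v) \<le> K * (Re (form_val t u u) + Re (form_val t v v))"
    if uv: "u \<in> form_dom t" "v \<in> form_dom t" for u v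
  proof -
    have iv: "\<i> *\<^sub>C v \<in> form_dom t" using uv by simp
    note lin = form_add_left form_add_right form_diff_left form_diff_right form_scale_left
      form_scale_right
    let ?q = "\<lambda>w. form_val t w w"
    have "4 * form_val t u v =
        ?q (u + v) - ?q (u - v) + \<i> * ?q (u + \<i> *\<^sub>C v) - \<i> * ?q (u - \<i> *\<^sub>C v)"
      using uv iv by (simp add: lin algebra_simps)
    then have "cmod (4 * form_val t u v) \<le> cmod (?q (u + v)) + cmod (?q (u - v))
        + cmod (?q (u + \<i> *\<^sub>C v)) + cmod (?q (u - \<i> *\<^sub>C v))"
      by (simp only:) (intro order_trans[OF norm_triangle_ineq4] order_trans[OF norm_triangle_ineq]
          add_mono, simp_all add: norm_mult)
    also have "\<dots> \<le> K * Re (?q (u + v)) + K * Re (?q (u - v))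
        + K * Re (?q (u + \<i> *\<^sub>C v)) + K * Re (?q (u - \<i> *\<^sub>C v))"
      using uv iv by (intro add_mono K) auto
    also have "\<dots> = 4 * (K * (Re (form_val t u u) + Re (form_val t v v)))"
      using uv iv by (simp add: lin algebra_simps)
    finally show ?thesis by (simp add: norm_mult)
  qed
  have "(cmod (form_val t u v))\<^sup>2 \<le> (2 * K)\<^sup>2 * Re (form_val t u u) * Re (form_val t v v)"
    if uv: "u \<in> form_dom t" "v \<in> form_dom t" for u v
  proof -
    \<comment> \<open>Replacing \<open>u\<close> by a real multiple \<open>s\<close> of it turns the
      additive bound \<open>le\<close> into a nonnegative quadratic in \<open>s\<close>. Its
      discriminant is the multiplicative bound, and the half on the left is the reason for the
      constant \<open>(2 * K)\<^sup>2\<close>.\<close>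
    have "(cmod (form_val t u v) / 2)\<^sup>2 \<le> (K * Re (form_val t u u)) * (K * Re (form_val t v v))"
    proof (rule quadratic_nonneg_imp)
      fix s :: real
      have "- s * cmod (form_val t u v) \<le> \<bar>s\<bar> * cmod (form_val t u v)"
        by (intro mult_right_mono) auto
      also have "\<dots> = cmod (form_val t (complex_of_real s *\<^sub>C u) v)"
        using uv by (simp add: form_scale_left norm_mult)
      also have "\<dots> \<le> K * (s\<^sup>2 * Re (form_val t u u) + Re (form_val t v v))"
        using le[of "complex_of_real s *\<^sub>C u" v] uv
        by (simp add: form_scale_left form_scale_right power2_eq_square mult.assoc)
      finally show "0 \<le> K * Re (form_val t u u) * s\<^sup>2 + 2 * (cmod (form_val t u v) / 2) * s
          + K * Re (form_val t v v)"
        by (simp add: algebra_simps)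
    qed (use K uv Re_nonneg in auto)
    then show ?thesis by (simp add: power2_eq_square algebra_simps)
  qed
  then show ?thesis by (intro exI[of _ "(2 * K)\<^sup>2"]) auto
qed

lemma Re_add_le:
  assumes "u \<in> form_dom t" "v \<in> form_dom t"
  shows "Re (form_val t (u + v) (u + v)) \<le> 2 * Re (form_val t u u) + 2 * Re (form_val t v v)"
  using Re_nonneg[of "u - v"] assms
  by (simp add: form_add_left form_add_right form_diff_left form_diff_right)

lemma diff_commute:
  assumes "u \<in> form_dom t" "v \<in> form_dom t"
  shows "form_val t (u - v) (u - v) = form_val t (v - u) (v - u)"
  using assms by (simp add: form_diff_left form_diff_right)

lemma form_tendsto_0:
  assumes "\<And>n. u n \<in> form_dom t" "\<And>n. v n \<in> form_dom t"
    and "(\<lambda>n. Re (form_val t (u n) (u n)) * Re (form_val t (v n) (v n))) \<longlonglongrightarrow> 0"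
  shows "(\<lambda>n. form_val t (u n) (v n)) \<longlonglongrightarrow> 0"
proof -
  obtain K where K: "\<And>u v. \<lbrakk>u \<in> form_dom t; v \<in> form_dom t\<rbrakk> \<Longrightarrow>
      (cmod (form_val t u v))\<^sup>2 \<le> K * Re (form_val t u u) * Re (form_val t v v)"
    using cmod_le_Re by blast
  show ?thesis
  proof (rule tendsto_0_if_square_le)
    show "(cmod (form_val t (u n) (v n)))\<^sup>2
        \<le> K * (Re (form_val t (u n) (u n)) * Re (form_val t (v n) (v n)))" for n
      using K[OF assms(1,2)] by (simp add: mult.assoc)
    show "(\<lambda>n. K * (Re (form_val t (u n) (u n)) * Re (form_val t (v n) (v n)))) \<longlonglongrightarrow> 0"
      using tendsto_mult_right_zero[OF assms(3)] .
  qed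
qed

text \<open>Expand around \<open>(u', v')\<close>: each of the three error terms tends to 0 by the
  Cauchy--Schwarz inequality up to a constant.\<close>

lemma form_tendsto:
  assumes u: "\<And>n. u n \<in> form_dom t" "u' \<in> form_dom t"
    and v: "\<And>n. v n \<in> form_dom t" "v' \<in> form_dom t"
    and "(\<lambda>n. form_val t (u n - u') (u n - u')) \<longlonglongrightarrow> 0"
    and "(\<lambda>n. form_val t (v n - v') (v n - v')) \<longlonglongrightarrow> 0"
  shows "(\<lambda>n. form_val t (u n) (v n)) \<longlonglongrightarrow> form_val t u' v'"
proof -
  have lim: "(\<lambda>n. Re (form_val t (u n - u') (u n - u'))) \<longlonglongrightarrow> 0"
    "(\<lambda>n. Re (form_val t (v n - v') (v n - v'))) \<longlonglongrightarrow> 0"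
    using tendsto_Re[OF assms(5)] tendsto_Re[OF assms(6)] by simp_all
  have "(\<lambda>n. form_val t (u n - u') (v n - v')) \<longlonglongrightarrow> 0"
    "(\<lambda>n. form_val t (u n - u') v') \<longlonglongrightarrow> 0" "(\<lambda>n. form_val t u' (v n - v')) \<longlonglongrightarrow> 0"
    using u v lim tendsto_mult[OF lim] tendsto_mult_left_zero[OF lim(1)]
      tendsto_mult_right_zero[OF lim(2)]
    by (auto intro!: form_tendsto_0)
  from tendsto_add[OF tendsto_add[OF this(1,2)] tendsto_add[OF this(3) tendsto_const]]
  have "(\<lambda>n. form_val t (u n - u') (v n - v') + form_val t (u n - u') v'
      + (form_val t u' (v n - v') + form_val t u' v')) \<longlonglongrightarrow> form_val t u' v'"
    by simp
  moreover have "form_val t (u n - u') (v n - v') + form_val t (u n - u') v'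
      + (form_val t u' (v n - v') + form_val t u' v') = form_val t (u n) (v n)" for n
    using u v by (simp add: form_diff_left form_diff_right)
  ultimately show ?thesis by simp
qed

lemma form_cauchy:
  assumes u: "\<And>n. u n \<in> form_dom t" "u' \<in> form_dom t"
    and "(\<lambda>n. form_val t (u n - u') (u n - u')) \<longlonglongrightarrow> 0" and "e > 0"
  shows "\<exists>N. \<forall>m\<ge>N. \<forall>n\<ge>N. cmod (form_val t (u n - u m) (u n - u m)) < e"
proof -
  obtain K where K: "K \<ge> 1" "\<And>u. u \<in> form_dom t \<Longrightarrow> cmod (form_val t u u) \<le> K * Re (form_val t u u)"
    using cmod_diag_le by blast
  \<comment> \<open>The factor 4 comes from two distances below \<open>d\<close>, each doubled by
    \<open>Re_add_le\<close>; the factor \<open>K\<close> passes from the real part to the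
    modulus.\<close>
  define d where "d = e / (4 * K)"
  have d: "d > 0" "4 * K * d = e" using K(1) \<open>e > 0\<close> by (simp_all add: d_def)
  note d(1)
  moreover have "(\<lambda>n. Re (form_val t (u n - u') (u n - u'))) \<longlonglongrightarrow> 0"
    using tendsto_Re[OF assms(3)] by simp
  ultimately have "\<forall>\<^sub>F n in sequentially. Re (form_val t (u n - u') (u n - u')) < d"
    by (rule order_tendstoD(2)[rotated])
  then obtain N where N: "\<And>n. n \<ge> N \<Longrightarrow> Re (form_val t (u n - u') (u n - u')) < d"
    unfolding eventually_sequentially by blast
  have "cmod (form_val t (u n - u m) (u n - u m)) < e" if "m \<ge> N" "n \<ge> N" for m n
  proof -
    have "cmod (form_val t (u n - u m) (u n - u m)) \<le> K * Re (form_val t (u n - u m) (u n - u m))"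
      using u by (intro K) auto
    moreover have "u n - u' \<in> form_dom t" "u' - u m \<in> form_dom t" using u by auto
    from Re_add_le[OF this]
    have "Re (form_val t (u n - u m) (u n - u m)) < 4 * d"
      using diff_commute[OF u(1)[of m] u(2)] N[OF that(1)] N[OF that(2)] by simp
    then have "K * Re (form_val t (u n - u m) (u n - u m)) < K * (4 * d)" using K(1) by simp
    ultimately show ?thesis using d(2) by (simp add: mult.assoc)
  qed
  then show ?thesis by blast
qed

end

text \<open>Density in the form norm. Convergence in the Hilbert space is demanded separately
  because the form may vanish on nonzero vectors.\<close>

definition form_core :: "'a::complex_inner set \<Rightarrow> 'a form \<Rightarrow> bool" where
  "form_core D t \<longleftrightarrow> csubspace D \<and> D \<subseteq> form_dom t \<and>
    (\<forall>\<phi>\<in>form_dom t. \<exists>s. (\<forall>n. s n \<in> D) \<and> s \<longlonglongrightarrow> \<phi> \<and>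
      (\<lambda>n. form_val t (s n - \<phi>) (s n - \<phi>)) \<longlonglongrightarrow> 0)"

lemma form_coreE:
  assumes "form_core D t" "\<phi> \<in> form_dom t"
  obtains s where "\<And>n. s n \<in> D" "s \<longlonglongrightarrow> \<phi>"
    "(\<lambda>n. form_val t (s n - \<phi>) (s n - \<phi>)) \<longlonglongrightarrow> 0"
proof -
  have "\<exists>s. (\<forall>n. s n \<in> D) \<and> s \<longlonglongrightarrow> \<phi> \<and> (\<lambda>n. form_val t (s n - \<phi>) (s n - \<phi>)) \<longlonglongrightarrow> 0"
    using assms by (simp add: form_core_def)
  then show ?thesis using that by blast
qed

lemma closed_sectorial_formD:
  "closed_sectorial_form t \<Longrightarrow> sectorial_form_on t"
  by (simp add: closed_sectorial_form_def sectorial_form_on_def)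

text \<open>A sequence in the core that converges for \<open>t\<close> is Cauchy for
  \<open>v\<close>, as both forms agree on differences of core vectors. Closedness of
  \<open>v\<close> puts the limit into its domain, and continuity carries the agreement of values
  from the core to the whole domain of \<open>t\<close>.\<close>

lemma form_extends_if_core:
  assumes t: "sectorial_form t" and v: "closed_sectorial_form v"
    and core: "form_core D t" and D: "D \<subseteq> form_dom v"
    and agree: "\<And>\<phi> \<psi>. \<lbrakk>\<phi> \<in> D; \<psi> \<in> D\<rbrakk> \<Longrightarrow> form_val v \<phi> \<psi> = form_val t \<phi> \<psi>"
  shows "form_extends v t"
proof -
  interpret t: sectorial_form_on t by standard fact
  interpret v: sectorial_form_on v using v by (rule closed_sectorial_formD)
  have lim: "\<phi> \<in> form_dom v \<and> (\<lambda>n. form_val v (s n - \<phi>) (s n - \<phi>)) \<longlonglongrightarrow> 0"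
    if s: "\<And>n. s n \<in> D" "s \<longlonglongrightarrow> \<phi>" "(\<lambda>n. form_val t (s n - \<phi>) (s n - \<phi>)) \<longlonglongrightarrow> 0" "\<phi> \<in> form_dom t"
    for s \<phi>
  proof -
    have "s n - s m \<in> D" for m n
      using core s(1) by (simp add: form_core_def complex_vector.subspace_diff)
    then have "form_val v (s n - s m) (s n - s m) = form_val t (s n - s m) (s n - s m)" for m n
      by (intro agree)
    moreover have "s n \<in> form_dom t" "s n \<in> form_dom v" for n
      using s(1) core D by (auto simp: form_core_def)
    ultimately have "\<forall>e>0. \<exists>N. \<forall>m\<ge>N. \<forall>n\<ge>N. cmod (form_val v (s n - s m) (s n - s m)) < e"
      "\<forall>n. s n \<in> form_dom v"
      using t.form_cauchy[of s \<phi>] s(3,4) by simp_all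
    then show ?thesis
      using v s(2) unfolding closed_sectorial_form_def by blast
  qed
  have "\<phi> \<in> form_dom v" if \<phi>: "\<phi> \<in> form_dom t" for \<phi>
  proof -
    obtain s where "\<And>n. s n \<in> D" "s \<longlonglongrightarrow> \<phi>" "(\<lambda>n. form_val t (s n - \<phi>) (s n - \<phi>)) \<longlonglongrightarrow> 0"
      using form_coreE[OF core \<phi>] by metis
    from lim[OF this \<phi>] show ?thesis ..
  qed
  moreover have "form_val v \<phi> \<psi> = form_val t \<phi> \<psi>" if \<phi>: "\<phi> \<in> form_dom t" and \<psi>: "\<psi> \<in> form_dom t"
    for \<phi> \<psi>
  proof -
    obtain s where s: "\<And>n. s n \<in> D" "s \<longlonglongrightarrow> \<phi>" "(\<lambda>n. form_val t (s n - \<phi>) (s n - \<phi>)) \<longlonglongrightarrow> 0"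
      using form_coreE[OF core \<phi>] by metis
    obtain r where r: "\<And>n. r n \<in> D" "r \<longlonglongrightarrow> \<psi>" "(\<lambda>n. form_val t (r n - \<psi>) (r n - \<psi>)) \<longlonglongrightarrow> 0"
      using form_coreE[OF core \<psi>] by metis
    have D': "D \<subseteq> form_dom t" using core by (simp add: form_core_def)
    have "(\<lambda>n. form_val t (s n) (r n)) \<longlonglongrightarrow> form_val t \<phi> \<psi>"
      using s r \<phi> \<psi> D' by (intro t.form_tendsto) auto
    moreover have "(\<lambda>n. form_val v (s n) (r n)) \<longlonglongrightarrow> form_val v \<phi> \<psi>"
      using s(1) r(1) D lim[OF s \<phi>] lim[OF r \<psi>] by (intro v.form_tendsto) auto
    ultimately show ?thesis
      using agree s(1) r(1) by (simp add: LIMSEQ_unique)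
  qed
  ultimately show ?thesis by (auto simp: form_extends_def)
qed

text \<open>Equality off the common domain rests on the convention that forms vanish there.\<close>

lemma form_extends_antisym:
  assumes "sesquilinear_form t" "sesquilinear_form u" "form_extends t u" "form_extends u t"
  shows "t = u"
proof (rule prod_eqI)
  show dom: "form_dom t = form_dom u" using assms(3,4) by (auto simp: form_extends_def)
  show "form_val t = form_val u"
  proof (intro ext)
    fix \<phi> \<psi>
    show "form_val t \<phi> \<psi> = form_val u \<phi> \<psi>"
      using assms dom unfolding form_extends_def sesquilinear_form_def by metis
  qed
qed

text \<open>A closed extension with core \<open>form_dom t\<close> is contained in every other
  closed extension, and antisymmetry makes it the only least one.\<close>

lemma form_closure_eq:
  assumes u: "closed_sectorial_form u" and ext: "form_extends u t" and core: "form_core (form_dom t) u"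
  shows "form_closure t = u"
  unfolding form_closure_def
proof (rule the_equality)
  have least: "form_extends v u" if "closed_sectorial_form v" "form_extends v t" for v
  proof (rule form_extends_if_core[OF _ that(1) core])
    show "sectorial_form u" using u by (simp add: closed_sectorial_form_def)
  qed (use ext that(2) in \<open>auto simp: form_extends_def\<close>)
  then show "closed_sectorial_form u \<and> form_extends u t
      \<and> (\<forall>v. closed_sectorial_form v \<and> form_extends v t \<longrightarrow> form_extends v u)"
    using u ext by blast
  fix w
  assume w: "closed_sectorial_form w \<and> form_extends w t
      \<and> (\<forall>v. closed_sectorial_form v \<and> form_extends v t \<longrightarrow> form_extends v w)"
  moreover from this have "form_extends w u" using least by blast
  moreover have "form_extends u w" using w u ext by blast
  ultimately show "w = u"
    using u by (intro form_extends_antisym) (simp_all add: closed_sectorial_form_def sectorial_form_def)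
qed

text \<open>The inner product of the form norm. A sectorial form is not symmetric, hence the
  symmetrization; the added \<open>inner u v\<close> makes it positive definite.\<close>

definition form_inner :: "'a::complex_inner form \<Rightarrow> 'a \<Rightarrow> 'a \<Rightarrow> real" where
  "form_inner t u v = (Re (form_val t u v) + Re (form_val t v u)) / 2 + inner u v"

lemma form_inner_self: "form_inner t u u = Re (form_val t u u) + (norm u)\<^sup>2"
  by (simp add: form_inner_def power2_norm_eq_inner)

lemma csubspace_rel_of_form:
  assumes "sectorial_form t"
  shows "csubspace (rel_of_form t)"
proof -
  interpret sectorial_form_on t by standard fact
  show ?thesis
    by (rule complex_vector.subspaceI)
      (auto simp: rel_of_form_def zero_prod_def scaleC_prod_def form_add_left form_scale_left
        cinner_add_left cinner_scaleC_left form_diff_left[of 0 0, simplified])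
qed

lemma sectorial_rel_of_form:
  assumes "sectorial_form t"
  shows "sectorial (rel_of_form t)"
proof -
  obtain \<alpha> where \<alpha>: "0 \<le> \<alpha>" "\<alpha> < pi / 2"
    and le: "\<And>u. u \<in> form_dom t \<Longrightarrow> 0 \<le> Re (form_val t u u)
      \<and> \<bar>Im (form_val t u u)\<bar> \<le> tan \<alpha> * Re (form_val t u u)"
    using assms unfolding sectorial_form_def by blast
  have "\<forall>(h, h')\<in>rel_of_form t. 0 \<le> Re (cinner h' h) \<and>
        \<bar>Im (cinner h' h)\<bar> \<le> tan \<alpha> * Re (cinner h' h)"
  proof clarify
    fix h h' assume "(h, h') \<in> rel_of_form t"
    then have "h \<in> form_dom t" "cinner h' h = form_val t h h"
      by (auto simp: rel_of_form_def)
    then show "0 \<le> Re (cinner h' h) \<and> \<bar>Im (cinner h' h)\<bar> \<le> tan \<alpha> * Re (cinner h' h)"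
      using le by simp
  qed
  then show ?thesis
    unfolding sectorial_def using csubspace_rel_of_form[OF assms] \<alpha> by blast
qed

section \<open>Closed forms and their maximal sectorial relations\<close>

locale closed_form = sectorial_form_on t for t :: "'a::chilbert_space form" +
  assumes closed: "closed_sectorial_form t"
begin

text \<open>Completeness is closedness in disguise: a Cauchy sequence for \<open>form_inner\<close>
  is Cauchy in the Hilbert space and, since \<open>K\<close> times the real part dominates the
  modulus, also Cauchy for the form.\<close>

lemma hilbert: "hilbert_form (form_dom t) (form_inner t)"
proof
  show "subspace (form_dom t)" by (rule csubspace_imp_subspace[OF csubspace_dom])
  show "form_inner t u v = form_inner t v u" for u v
    by (simp add: form_inner_def inner_commute)
  show "form_inner t (u + v) w = form_inner t u w + form_inner t v w"
    if "u \<in> form_dom t" "v \<in> form_dom t" "w \<in> form_dom t" for u v w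
    using that by (simp add: form_inner_def form_add_left form_add_right inner_add_left field_simps)
  show "form_inner t (r *\<^sub>R u) v = r * form_inner t u v"
    if "u \<in> form_dom t" "v \<in> form_dom t" for r u v
  proof -
    have "form_val t (r *\<^sub>R u) v = r * form_val t u v" "form_val t v (r *\<^sub>R u) = r * form_val t v u"
      using that by (simp_all add: scaleR_scaleC form_scale_left form_scale_right)
    then show ?thesis by (simp add: form_inner_def field_simps)
  qed
  show "0 < form_inner t u u" if "u \<in> form_dom t" "u \<noteq> 0" for u
    using Re_nonneg[OF that(1)] that(2) by (simp add: form_inner_self add_nonneg_pos)
  show "\<exists>l\<in>form_dom t. (\<lambda>n. form_inner t (s n - l) (s n - l)) \<longlonglongrightarrow> 0"
    if s: "\<And>n. s n \<in> form_dom t"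
      and cauchy: "\<And>e. e > 0 \<Longrightarrow> \<exists>N. \<forall>m\<ge>N. \<forall>n\<ge>N. form_inner t (s n - s m) (s n - s m) < e" for s
  proof -
    obtain K where K: "K \<ge> 1" "\<And>u. u \<in> form_dom t \<Longrightarrow> cmod (form_val t u u) \<le> K * Re (form_val t u u)"
      using cmod_diag_le by blast
    have "Cauchy s"
    proof (rule CauchyI)
      fix e :: real assume "e > 0"
      then obtain N where N: "\<forall>m\<ge>N. \<forall>n\<ge>N. form_inner t (s n - s m) (s n - s m) < e\<^sup>2"
        using cauchy[of "e\<^sup>2"] by auto
      have "norm (s n - s m) < e" if "m \<ge> N" "n \<ge> N" for m n
      proof (rule power2_less_imp_less)
        have "form_inner t (s n - s m) (s n - s m) < e\<^sup>2" using N that by blast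
        moreover have "0 \<le> Re (form_val t (s n - s m) (s n - s m))"
          using s by (intro Re_nonneg) auto
        ultimately show "(norm (s n - s m))\<^sup>2 < e\<^sup>2" by (simp add: form_inner_self)
      qed (use \<open>e > 0\<close> in simp)
      then show "\<exists>N. \<forall>m\<ge>N. \<forall>n\<ge>N. norm (s m - s n) < e" by blast
    qed
    then obtain l where l: "s \<longlonglongrightarrow> l" using convergent_eq_Cauchy by blast
    have "\<forall>e>0. \<exists>N. \<forall>m\<ge>N. \<forall>n\<ge>N. cmod (form_val t (s n - s m) (s n - s m)) < e"
    proof (intro allI impI)
      fix e :: real assume "e > 0"
      then obtain N where N: "\<forall>m\<ge>N. \<forall>n\<ge>N. form_inner t (s n - s m) (s n - s m) < e / K"
        using cauchy[of "e / K"] K(1) by auto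
      have "cmod (form_val t (s n - s m) (s n - s m)) < e" if "m \<ge> N" "n \<ge> N" for m n
      proof -
        have "Re (form_val t (s n - s m) (s n - s m)) \<le> form_inner t (s n - s m) (s n - s m)"
          by (simp add: form_inner_self)
        also have "\<dots> < e / K" using N that by blast
        finally have "K * Re (form_val t (s n - s m) (s n - s m)) < e"
          using K(1) by (simp add: pos_less_divide_eq mult.commute)
        moreover have "cmod (form_val t (s n - s m) (s n - s m))
            \<le> K * Re (form_val t (s n - s m) (s n - s m))"
          using s by (intro K) auto
        ultimately show ?thesis by simp
      qed
      then show "\<exists>N. \<forall>m\<ge>N. \<forall>n\<ge>N. cmod (form_val t (s n - s m) (s n - s m)) < e" by blast
    qed
    then have lt: "l \<in> form_dom t" "(\<lambda>n. form_val t (s n - l) (s n - l)) \<longlonglongrightarrow> 0"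
      using closed s l unfolding closed_sectorial_form_def by blast+
    have "(\<lambda>n. Re (form_val t (s n - l) (s n - l)) + (norm (s n - l))\<^sup>2) \<longlonglongrightarrow> Re 0 + (norm (l - l))\<^sup>2"
      by (intro tendsto_intros lt(2) l)
    then show ?thesis using lt(1) by (auto simp: form_inner_self)
  qed
qed

text \<open>Boundedness of the form of \<open>H + I\<close> in the form norm, as Lax--Milgram
  requires. The constant \<open>2 * K + 2\<close> arises from squaring a sum of two terms, bounded
  by \<open>K\<close> and by 1.\<close>

lemma shifted_bound:
  "\<exists>C\<ge>0. \<forall>u\<in>form_dom t. \<forall>v\<in>form_dom t.
    (cmod (form_val t u v + cinner u v))\<^sup>2 \<le> C * form_inner t u u * form_inner t v v"
proof -
  obtain K where K: "K \<ge> 0" "\<And>u v. \<lbrakk>u \<in> form_dom t; v \<in> form_dom t\<rbrakk> \<Longrightarrow>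
      (cmod (form_val t u v))\<^sup>2 \<le> K * Re (form_val t u u) * Re (form_val t v v)"
    using cmod_le_Re by blast
  have "(cmod (form_val t u v + cinner u v))\<^sup>2 \<le> (2 * K + 2) * form_inner t u u * form_inner t v v"
    if uv: "u \<in> form_dom t" "v \<in> form_dom t" for u v
  proof -
    let ?x = "cmod (form_val t u v)" and ?y = "cmod (cinner u v)"
    let ?N = "form_inner t u u * form_inner t v v"
    have nn: "0 \<le> Re (form_val t u u)" "0 \<le> Re (form_val t v v)" using Re_nonneg uv by auto
    have "(cmod (form_val t u v + cinner u v))\<^sup>2 \<le> (?x + ?y)\<^sup>2"
      by (intro power_mono norm_triangle_ineq) auto
    also have "\<dots> \<le> 2 * ?x\<^sup>2 + 2 * ?y\<^sup>2"
      using zero_le_power2[of "?x - ?y"] by (simp add: power2_eq_square algebra_simps)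
    also have "?x\<^sup>2 \<le> K * ?N"
    proof -
      have "Re (form_val t u u) * Re (form_val t v v) \<le> ?N"
        using nn by (intro mult_mono) (auto simp: form_inner_self)
      then have "K * (Re (form_val t u u) * Re (form_val t v v)) \<le> K * ?N"
        using K(1) by (rule mult_left_mono)
      then show ?thesis using K(2)[OF uv] by (simp add: mult.assoc)
    qed
    also have "?y\<^sup>2 \<le> ?N"
    proof -
      have "?y\<^sup>2 \<le> (norm u)\<^sup>2 * (norm v)\<^sup>2"
        using power_mono[OF cmod_cinner_le[of u v], of 2] by (simp add: power_mult_distrib)
      also have "\<dots> \<le> ?N" using nn by (intro mult_mono) (auto simp: form_inner_self)
      finally show ?thesis .
    qed
    finally show ?thesis by (simp add: algebra_simps)
  qed
  then show ?thesis using K(1) by (intro exI[of _ "2 * K + 2"]) auto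
qed

text \<open>The relation plus the identity is onto. The shifted form is coercive with constant 1,
  since the real part of its diagonal is exactly \<open>form_inner t u u\<close>.\<close>

lemma rel_of_form_range: "\<exists>u. (u, x - u) \<in> rel_of_form t"
proof -
  obtain C where C: "C \<ge> 0" "\<And>u v. \<lbrakk>u \<in> form_dom t; v \<in> form_dom t\<rbrakk> \<Longrightarrow>
      (cmod (form_val t u v + cinner u v))\<^sup>2 \<le> C * form_inner t u u * form_inner t v v"
    using shifted_bound by blast
  have "\<exists>u\<in>form_dom t. \<forall>v\<in>form_dom t. form_val t u v + cinner u v = cinner x v"
  proof (rule complex_lax_milgram[OF hilbert csubspace_dom, where C = C and c = 1 and K = "(norm x)\<^sup>2"])
    show "form_val t (r *\<^sub>R u) v + cinner (r *\<^sub>R u) v = complex_of_real r * (form_val t u v + cinner u v)"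
      if "u \<in> form_dom t" "v \<in> form_dom t" for r u v
      using that by (simp add: scaleR_scaleC form_scale_left cinner_scaleC_left algebra_simps)
    show "1 * form_inner t u u \<le> Re (form_val t u u + cinner u u)" for u
      by (simp add: form_inner_self cinner_self)
    show "(cmod (cinner x v))\<^sup>2 \<le> (norm x)\<^sup>2 * form_inner t v v" if "v \<in> form_dom t" for v
    proof -
      have "(cmod (cinner x v))\<^sup>2 \<le> (norm x)\<^sup>2 * (norm v)\<^sup>2"
        using power_mono[OF cmod_cinner_le[of x v], of 2] by (simp add: power_mult_distrib)
      also have "\<dots> \<le> (norm x)\<^sup>2 * form_inner t v v"
        using Re_nonneg[OF that] by (intro mult_left_mono) (auto simp: form_inner_self)
      finally show ?thesis .
    qed
  qed (use C in \<open>simp_all add: form_add_left form_add_right form_scale_right cinner_add_left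
      cinner_add_right cinner_scaleC_right algebra_simps\<close>)
  then obtain u where u: "u \<in> form_dom t"
    "\<And>v. v \<in> form_dom t \<Longrightarrow> form_val t u v + cinner u v = cinner x v" by blast
  then have "form_val t u v = cinner (x - u) v" if "v \<in> form_dom t" for v
    using u(2)[OF that] by (simp add: cinner.diff_left eq_diff_eq)
  then show ?thesis using u(1) by (auto simp: rel_of_form_def)
qed

text \<open>The vectors approximated by \<open>Domain (rel_of_form t)\<close> form a Hilbert space \<open>W\<close>. If \<open>u \<in> W\<close> solves the
  adjoint problem restricted to \<open>W\<close> with the data of \<open>w\<close>, then \<open>w - u\<close> is orthogonal to the range of
  \<open>rel_of_form t + I\<close>, which is the whole space.\<close>

lemma rel_of_form_core: "form_core (Domain (rel_of_form t)) t"
proof -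
  interpret hilbert_form "form_dom t" "form_inner t" by (rule hilbert)
  let ?D = "Domain (rel_of_form t)"
  let ?a = "\<lambda>v u. form_val t v u + cinner v u"
  define W where "W = {w \<in> form_dom t. \<forall>e>0. \<exists>v\<in>?D. form_inner t (v - w) (v - w) < e}"
  have csub: "csubspace (rel_of_form t)" using sectorial by (rule csubspace_rel_of_form)
  have D: "csubspace ?D" using csub by (rule csubspace_Domain)
  have Ddom: "?D \<subseteq> form_dom t" by (auto simp: rel_of_form_def)
  have DW: "?D \<subseteq> W"
  proof
    fix x assume x: "x \<in> ?D"
    have "form_inner t (x - x) (x - x) = 0" by simp
    then show "x \<in> W" using x Ddom by (auto simp: W_def simp del: diff_self intro!: bexI[of _ x])
  qed
  have Wdom: "W \<subseteq> form_dom t" by (auto simp: W_def)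
  interpret W: hilbert_form W "form_inner t"
    unfolding W_def using csubspace_imp_subspace[OF D] Ddom by (rule closure_hilbert_form)
  obtain C where C: "C \<ge> 0" "\<And>u v. \<lbrakk>u \<in> form_dom t; v \<in> form_dom t\<rbrakk> \<Longrightarrow>
      (cmod (?a u v))\<^sup>2 \<le> C * form_inner t u u * form_inner t v v"
    using shifted_bound by blast
  have Re_bound: "(Re (?a v u))\<^sup>2 \<le> C * form_inner t u u * form_inner t v v"
    if "u \<in> form_dom t" "v \<in> form_dom t" for u v
  proof -
    have "(Re (?a v u))\<^sup>2 \<le> (cmod (?a v u))\<^sup>2" by (simp add: cmod_power2)
    also have "\<dots> \<le> C * form_inner t v v * form_inner t u u" using that by (intro C(2))
    finally show ?thesis by (simp add: mult_ac)
  qed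
  have scaleR: "?a (r *\<^sub>R u) v = complex_of_real r * ?a u v" "?a u (r *\<^sub>R v) = complex_of_real r * ?a u v"
    if "u \<in> form_dom t" "v \<in> form_dom t" for r u v
    using that by (simp_all add: scaleR_scaleC form_scale_left form_scale_right cinner_scaleC_left
        cinner_scaleC_right algebra_simps)
  have "w \<in> W" if w: "w \<in> form_dom t" for w
  proof -
    \<comment> \<open>The unknown stands in the second argument, so this is the adjoint problem.
      Real parts are enough, because the \<open>v\<close> chosen below makes
      \<open>?a v (w - u)\<close> the real number \<open>cinner (w - u) (w - u)\<close>.\<close>
    have "\<exists>u\<in>W. \<forall>v\<in>W. Re (?a v u) = Re (?a v w)"
    proof (rule W.lax_milgram[where C = C and c = 1 and K = "C * form_inner t w w"])
      show "Re (?a w (u + v)) = Re (?a w u) + Re (?a w v)" "Re (?a (u + v) w) = Re (?a u w) + Re (?a v w)"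
        if "u \<in> W" "v \<in> W" "w \<in> W" for u v w
        using that subsetD[OF Wdom]
        by (simp_all add: form_add_left form_add_right cinner_add_left cinner_add_right)
      show "Re (?a v (r *\<^sub>R u)) = r * Re (?a v u)" "Re (?a (r *\<^sub>R u) v) = r * Re (?a u v)"
        if "u \<in> W" "v \<in> W" for r u v
        using that subsetD[OF Wdom] scaleR by simp_all
      show "(Re (?a v u))\<^sup>2 \<le> C * form_inner t u u * form_inner t v v" if "u \<in> W" "v \<in> W" for u v
        using that Wdom by (intro Re_bound) auto
      show "1 * form_inner t u u \<le> Re (?a u u)" for u
        by (simp add: form_inner_self cinner_self)
      show "Re (?a (u + v) w) = Re (?a u w) + Re (?a v w)" if "u \<in> W" "v \<in> W" for u v
        using that w subsetD[OF Wdom] by (simp add: form_add_left cinner_add_left)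
      show "Re (?a (r *\<^sub>R u) w) = r * Re (?a u w)" if "u \<in> W" for r u
        using that w subsetD[OF Wdom] scaleR by simp
      show "(Re (?a v w))\<^sup>2 \<le> C * form_inner t w w * form_inner t v v" if "v \<in> W" for v
        using that w Wdom by (intro Re_bound) auto
      show "0 \<le> C * form_inner t w w" using C(1) nonneg[OF w] by simp
    qed (use C in simp_all)
    then obtain u where u: "u \<in> W" "\<And>v. v \<in> W \<Longrightarrow> Re (?a v u) = Re (?a v w)" by blast
    obtain v where v: "(v, (w - u) - v) \<in> rel_of_form t" using rel_of_form_range by blast
    then have vD: "v \<in> ?D" by blast
    have dom: "u \<in> form_dom t" "v \<in> form_dom t" using u(1) vD Wdom Ddom by auto
    have "Re (?a v (w - u)) = 0"
      using u(2)[of v] vD DW dom w by (auto simp: form_diff_right cinner.diff_right)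
    moreover have "?a v (w - u) = cinner (w - u) (w - u)"
      using v dom w by (auto simp: rel_of_form_def cinner.diff_left)
    ultimately have "w = u" by (simp add: cinner_self)
    then show ?thesis using u(1) by simp
  qed
  moreover have "\<exists>s. (\<forall>n. s n \<in> ?D) \<and> s \<longlonglongrightarrow> w \<and> (\<lambda>n. form_val t (s n - w) (s n - w)) \<longlonglongrightarrow> 0"
    if w: "w \<in> W" for w
  proof -
    have "\<exists>v\<in>?D. form_inner t (v - w) (v - w) < inverse (real (Suc n))" for n
      using w by (simp add: W_def)
    then obtain s where s: "\<And>n. s n \<in> ?D" "\<And>n. form_inner t (s n - w) (s n - w) < inverse (real (Suc n))"
      by metis
    have dom: "s n - w \<in> form_dom t" for n using s(1) w Ddom Wdom by blast
    have "(\<lambda>n. s n - w) \<longlonglongrightarrow> 0"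
    proof (rule tendsto_0_if_square_le[OF _ LIMSEQ_inverse_real_of_nat])
      show "(norm (s n - w))\<^sup>2 \<le> inverse (real (Suc n))" for n
        using s(2)[of n] Re_nonneg[OF dom[of n]] by (simp add: form_inner_self)
    qed
    then have "s \<longlonglongrightarrow> w" by (simp add: LIM_zero_iff)
    obtain K where K: "K \<ge> 1" "\<And>u. u \<in> form_dom t \<Longrightarrow> cmod (form_val t u u) \<le> K * Re (form_val t u u)"
      using cmod_diag_le by blast
    have "(\<lambda>n. form_val t (s n - w) (s n - w)) \<longlonglongrightarrow> 0"
    proof (rule Lim_null_comparison)
      have "cmod (form_val t (s n - w) (s n - w)) \<le> K * inverse (real (Suc n))" for n
      proof -
        have "Re (form_val t (s n - w) (s n - w)) \<le> form_inner t (s n - w) (s n - w)"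
          by (simp add: form_inner_self)
        then have "Re (form_val t (s n - w) (s n - w)) \<le> inverse (real (Suc n))"
          using s(2)[of n] by linarith
        then have "K * Re (form_val t (s n - w) (s n - w)) \<le> K * inverse (real (Suc n))"
          using K(1) by (intro mult_left_mono) auto
        then show ?thesis using K(2)[OF dom[of n]] by linarith
      qed
      then show "\<forall>\<^sub>F n in sequentially. norm (form_val t (s n - w) (s n - w)) \<le> K * inverse (real (Suc n))"
        by (intro always_eventually allI)
      show "(\<lambda>n. K * inverse (real (Suc n))) \<longlonglongrightarrow> 0"
        by (rule tendsto_mult_right_zero[OF LIMSEQ_inverse_real_of_nat])
    qed
    then show ?thesis using s(1) \<open>s \<longlonglongrightarrow> w\<close> by blast
  qed
  ultimately show ?thesis using D Ddom by (simp add: form_core_def)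
qed

text \<open>For \<open>(h, h')\<close> in a sectorial extension, solve
  \<open>(H + I) u = h + h'\<close>. Subtracting the resulting pair leaves
  \<open>(h - u, u - h)\<close>, whose value \<open>- cinner (h - u) (h - u)\<close> must have
  nonnegative real part, so \<open>h = u\<close>.\<close>

lemma maximal_sectorial_rel_of_form: "maximal_sectorial (rel_of_form t)"
  unfolding maximal_sectorial_def
proof (intro conjI allI impI)
  show "sectorial (rel_of_form t)" using sectorial by (rule sectorial_rel_of_form)
  fix S' assume S': "sectorial S' \<and> rel_of_form t \<subseteq> S'"
  show "S' = rel_of_form t"
  proof
    show "rel_of_form t \<subseteq> S'" using S' by blast
    show "S' \<subseteq> rel_of_form t"
    proof (rule subrelI)
      fix h h' assume h: "(h, h') \<in> S'"
      obtain u where u: "(u, h + h' - u) \<in> rel_of_form t" using rel_of_form_range by blast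
      have sub: "csubspace S'" using S' by (simp add: sectorial_def)
      have "(u, h + h' - u) \<in> S'" using u S' by blast
      from complex_vector.subspace_diff[OF sub h this] have "(h - u, u - h) \<in> S'" by simp
      then have "0 \<le> Re (cinner (u - h) (h - u))" using S' unfolding sectorial_def by blast
      also have "cinner (u - h) (h - u) = - cinner (h - u) (h - u)"
        by (simp add: cinner.diff_left)
      finally have "h = u" by (simp add: cinner_self)
      then show "(h, h') \<in> rel_of_form t" using u by simp
    qed
  qed
qed

end

lemma closed_formI: "closed_sectorial_form t \<Longrightarrow> closed_form t"
  by (simp add: closed_form_def closed_form_axioms_def closed_sectorial_formD)

text \<open>On the domain of the relation, which is a core of \<open>t\<close>, the relation
  determines the values of both forms. Used in both directions, this gives uniqueness of the closed
  form.\<close>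

lemma form_extends_if_rel_eq:
  fixes t u :: "'a::chilbert_space form"
  assumes t: "closed_sectorial_form t" and u: "closed_sectorial_form u"
    and eq: "rel_of_form t = rel_of_form u"
  shows "form_extends u t"
proof (rule form_extends_if_core[OF _ u closed_form.rel_of_form_core[OF closed_formI[OF t]]])
  show "sectorial_form t" using t by (simp add: closed_sectorial_form_def)
  show "Domain (rel_of_form t) \<subseteq> form_dom u" unfolding eq by (auto simp: rel_of_form_def)
  fix \<phi> \<psi> assume "\<phi> \<in> Domain (rel_of_form t)" "\<psi> \<in> Domain (rel_of_form t)"
  then obtain \<phi>' \<psi>' where t: "(\<phi>, \<phi>') \<in> rel_of_form t" "(\<psi>, \<psi>') \<in> rel_of_form t"
    by blast
  then have "(\<phi>, \<phi>') \<in> rel_of_form u" "(\<psi>, \<psi>') \<in> rel_of_form u"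
    by (simp_all add: eq)
  with t show "form_val u \<phi> \<psi> = form_val t \<phi> \<psi>"
    by (simp add: rel_of_form_def)
qed

lemma closed_form_of_rel_of_form:
  fixes t :: "'a::chilbert_space form"
  assumes "closed_sectorial_form t"
  shows "closed_form_of (rel_of_form t) = t"
  unfolding closed_form_of_def
proof (rule the_equality)
  fix u assume u: "closed_sectorial_form u \<and> rel_of_form u = rel_of_form t"
  then show "u = t"
    using assms form_extends_if_rel_eq[of u t] form_extends_if_rel_eq[of t u]
    by (intro form_extends_antisym) (simp_all add: closed_sectorial_form_def sectorial_form_def)
qed (use assms in simp)

section \<open>Forms generated by operators\<close>

text \<open>Everything is required on \<open>M\<close> only, since \<open>Bm_of\<close> and
  \<open>inv_into\<close> are meaningful only there. Being closed under inversion, the locale covers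
  the Friedrichs and the Krein case at once.\<close>

locale coercive_map =
  fixes M :: "'k::chilbert_space set" and A :: "'k \<Rightarrow> 'k"
  assumes M: "csubspace M" "closed M"
    and maps_to [simp]: "x \<in> M \<Longrightarrow> A x \<in> M"
    and add: "\<lbrakk>x \<in> M; y \<in> M\<rbrakk> \<Longrightarrow> A (x + y) = A x + A y"
    and scale: "x \<in> M \<Longrightarrow> A (a *\<^sub>C x) = a *\<^sub>C A x"
    and bounded: "\<exists>C>0. \<forall>x\<in>M. norm (A x) \<le> C * norm x"
    and coercive: "\<exists>c>0. \<forall>x\<in>M. c * (norm x)\<^sup>2 \<le> Re (cinner (A x) x)"
begin

lemma M_ops [simp]:
  "0 \<in> M" "\<lbrakk>x \<in> M; y \<in> M\<rbrakk> \<Longrightarrow> x + y \<in> M" "\<lbrakk>x \<in> M; y \<in> M\<rbrakk> \<Longrightarrow> x - y \<in> M"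
  "x \<in> M \<Longrightarrow> a *\<^sub>C x \<in> M"
  using M
  by (auto simp: complex_vector.subspace_0 complex_vector.subspace_add complex_vector.subspace_diff
      complex_vector.subspace_scale)

lemma diff: "\<lbrakk>x \<in> M; y \<in> M\<rbrakk> \<Longrightarrow> A (x - y) = A x - A y"
  using add[of "x - y" y] by simp

lemma zero [simp]: "A 0 = 0"
  using diff[of 0 0] by simp

lemma hilbert_form_inner: "hilbert_form M inner"
  using M by (intro hilbert_form_inner csubspace_imp_subspace)

lemma cinner_le:
  "\<exists>C\<ge>0. \<forall>x\<in>M. \<forall>y\<in>M. (cmod (cinner (A x) y))\<^sup>2 \<le> C * inner x x * inner y y"
proof -
  obtain C where C: "C > 0" "\<And>x. x \<in> M \<Longrightarrow> norm (A x) \<le> C * norm x" using bounded by blast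
  have "(cmod (cinner (A x) y))\<^sup>2 \<le> C\<^sup>2 * inner x x * inner y y" if "x \<in> M" for x y
  proof -
    have "(norm (A x))\<^sup>2 \<le> C\<^sup>2 * inner x x"
      using power_mono[OF C(2)[OF that], of 2] by (simp add: power_mult_distrib power2_norm_eq_inner)
    then have "(norm (A x))\<^sup>2 * inner y y \<le> C\<^sup>2 * inner x x * inner y y"
      by (intro mult_right_mono) auto
    then show ?thesis using cmod_cinner_square_le[of "A x" y] by linarith
  qed
  then show ?thesis by (intro exI[of _ "C\<^sup>2"]) auto
qed

lemma surj: "y \<in> M \<Longrightarrow> \<exists>x\<in>M. A x = y"
proof -
  assume y: "y \<in> M"
  obtain c where c: "c > 0" "\<And>x. x \<in> M \<Longrightarrow> c * inner x x \<le> Re (cinner (A x) x)"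
    using coercive by (auto simp: power2_norm_eq_inner)
  obtain C where C: "C \<ge> 0" "\<And>x y. \<lbrakk>x \<in> M; y \<in> M\<rbrakk> \<Longrightarrow>
      (cmod (cinner (A x) y))\<^sup>2 \<le> C * inner x x * inner y y" using cinner_le by blast
  have "\<exists>x\<in>M. \<forall>z\<in>M. cinner (A x) z = cinner y z"
    by (rule complex_lax_milgram[OF hilbert_form_inner M(1), where C = C and c = c and K = "(norm y)\<^sup>2"])
      (use c C in \<open>simp_all add: add scale scaleR_scaleC cinner_add_left cinner_add_right
        cinner_scaleC_left cinner_scaleC_right cmod_cinner_square_le\<close>)
  then show ?thesis using y csubspace_cinner_eqI[OF M(1)] by (metis maps_to)
qed

text \<open>Solves the equation for the adjoint of \<open>A\<close> on \<open>M\<close>. The form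
  \<open>cinner u (A v)\<close> inherits bound and coercivity from \<open>A\<close>, and an
  arbitrary \<open>y\<close>, possibly outside \<open>M\<close>, still defines a bounded functional
  on \<open>M\<close>.\<close>

lemma adjoint_surj: "\<exists>k\<in>M. \<forall>x\<in>M. cinner k (A x) = cinner y x"
proof -
  obtain c where c: "c > 0" "\<And>x. x \<in> M \<Longrightarrow> c * inner x x \<le> Re (cinner (A x) x)"
    using coercive by (auto simp: power2_norm_eq_inner)
  obtain C where C: "C \<ge> 0" "\<And>x y. \<lbrakk>x \<in> M; y \<in> M\<rbrakk> \<Longrightarrow>
      (cmod (cinner (A x) y))\<^sup>2 \<le> C * inner x x * inner y y" using cinner_le by blast
  have swap: "cmod (cinner u (A v)) = cmod (cinner (A v) u)" "Re (cinner u (A v)) = Re (cinner (A v) u)"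
    for u v by (subst cinner_commute, simp)+
  show ?thesis
  proof (rule complex_lax_milgram[OF hilbert_form_inner M(1), where C = C and c = c and K = "(norm y)\<^sup>2"])
    show "(cmod (cinner u (A v)))\<^sup>2 \<le> C * inner u u * inner v v" if "u \<in> M" "v \<in> M" for u v
      using C(2)[OF that(2,1)] by (simp add: swap mult_ac)
  qed (use c C in \<open>simp_all add: add scale scaleR_scaleC cinner_add_left cinner_add_right swap
        cinner_scaleC_left cinner_scaleC_right cmod_cinner_square_le\<close>)
qed

lemma inj: "inj_on A M"
proof (rule inj_onI)
  fix x y assume xy: "x \<in> M" "y \<in> M" "A x = A y"
  obtain c where c: "c > 0" "\<And>x. x \<in> M \<Longrightarrow> c * (norm x)\<^sup>2 \<le> Re (cinner (A x) x)"
    using coercive by blast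
  have "c * (norm (x - y))\<^sup>2 \<le> 0" using c(2)[of "x - y"] xy by (simp add: diff)
  then show "x = y" using c(1) by (simp add: mult_le_0_iff)
qed

lemma
  shows inv_maps_to: "y \<in> M \<Longrightarrow> inv_into M A y \<in> M"
    and inv_right: "y \<in> M \<Longrightarrow> A (inv_into M A y) = y"
    and inv_left: "x \<in> M \<Longrightarrow> inv_into M A (A x) = x"
proof -
  assume "y \<in> M"
  then have "y \<in> A ` M" using surj by blast
  then show "inv_into M A y \<in> M" "A (inv_into M A y) = y"
    by (simp_all add: inv_into_into f_inv_into_f)
qed (simp add: inj)

lemma graph_on_inv: "graph_on M (inv_into M A) = (graph_on M A)\<inverse>"
  by (auto simp: graph_on_def inv_maps_to inv_right inv_left)

text \<open>Coercivity with constant \<open>c\<close> bounds the inverse by \<open>1 / c\<close>.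
  With \<open>y = A x\<close> the real part for the inverse at \<open>y\<close> is that for
  \<open>A\<close> at \<open>x\<close>, hence at least \<open>c * (norm x)\<^sup>2\<close>; the
  bound \<open>C\<close> of \<open>A\<close> turns this into \<open>c / C\<^sup>2\<close> times
  \<open>(norm y)\<^sup>2\<close>.\<close>

lemma inverse: "coercive_map M (inv_into M A)"
proof
  note inv = inv_maps_to inv_right inv_left
  show "csubspace M" "closed M" by (fact M)+
  show "inv_into M A x \<in> M" if "x \<in> M" for x using that by (rule inv_maps_to)
  show "inv_into M A (x + y) = inv_into M A x + inv_into M A y" if "x \<in> M" "y \<in> M" for x y
    using inv_left[of "inv_into M A x + inv_into M A y"] that by (simp add: inv add)
  show "inv_into M A (a *\<^sub>C x) = a *\<^sub>C inv_into M A x" if "x \<in> M" for a x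
    using inv_left[of "a *\<^sub>C inv_into M A x"] that by (simp add: inv scale)
  obtain c where c: "c > 0" "\<And>x. x \<in> M \<Longrightarrow> c * (norm x)\<^sup>2 \<le> Re (cinner (A x) x)"
    using coercive by blast
  have lower: "c * norm x \<le> norm (A x)" if "x \<in> M" for x
  proof (cases "x = 0")
    case False
    have "c * (norm x)\<^sup>2 \<le> cmod (cinner (A x) x)"
      using c(2)[OF that] complex_Re_le_cmod order_trans by blast
    also have "\<dots> \<le> norm (A x) * norm x" by (rule cmod_cinner_le)
    finally show ?thesis using False by (simp add: power2_eq_square)
  qed simp
  show "\<exists>C>0. \<forall>x\<in>M. norm (inv_into M A x) \<le> C * norm x"
  proof (intro exI[of _ "1 / c"] conjI ballI)
    show "norm (inv_into M A x) \<le> 1 / c * norm x" if "x \<in> M" for x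
      using lower[of "inv_into M A x"] that c(1) by (simp add: inv field_simps)
  qed (use c in simp)
  obtain C where C: "C > 0" "\<And>x. x \<in> M \<Longrightarrow> norm (A x) \<le> C * norm x" using bounded by blast
  show "\<exists>c>0. \<forall>x\<in>M. c * (norm x)\<^sup>2 \<le> Re (cinner (inv_into M A x) x)"
  proof (intro exI[of _ "c / C\<^sup>2"] conjI ballI)
    fix y assume y: "y \<in> M"
    define x where "x = inv_into M A y"
    have x: "x \<in> M" "A x = y" using y by (simp_all add: x_def inv)
    have "(norm y)\<^sup>2 \<le> C\<^sup>2 * (norm x)\<^sup>2"
      using power_mono[OF C(2)[OF x(1)], of 2] x(2) by (simp add: power_mult_distrib)
    then have "c * (norm y)\<^sup>2 \<le> c * (C\<^sup>2 * (norm x)\<^sup>2)"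
      using c(1) by (intro mult_left_mono) auto
    then have "c / C\<^sup>2 * (norm y)\<^sup>2 \<le> c * (norm x)\<^sup>2" using C(1) by (simp add: field_simps)
    also have "\<dots> \<le> Re (cinner y x)" using c(2)[OF x(1)] x(2) by simp
    also have "\<dots> = Re (cinner x y)" by (subst cinner_commute) simp
    finally show "c / C\<^sup>2 * (norm y)\<^sup>2 \<le> Re (cinner (inv_into M A y) y)" by (simp add: x_def)
  qed (use c C in simp)
qed

lemma tendsto:
  assumes "\<And>n. x n \<in> M" "y \<in> M" "x \<longlonglongrightarrow> y"
  shows "(\<lambda>n. A (x n)) \<longlonglongrightarrow> A y"
proof -
  obtain C where C: "\<And>x. x \<in> M \<Longrightarrow> norm (A x) \<le> C * norm x" using bounded by blast
  have "(\<lambda>n. A (x n) - A y) \<longlonglongrightarrow> 0"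
  proof (rule Lim_null_comparison)
    show "\<forall>\<^sub>F n in sequentially. norm (A (x n) - A y) \<le> C * norm (x n - y)"
      using C[of "x _ - y"] assms by (simp add: diff)
    have "(\<lambda>n. C * norm (x n - y)) \<longlonglongrightarrow> C * norm (y - y)"
      by (intro tendsto_intros assms)
    then show "(\<lambda>n. C * norm (x n - y)) \<longlonglongrightarrow> 0" by simp
  qed
  then show ?thesis by (simp add: LIM_zero_iff)
qed

end

lemma rel_app_eq: "\<lbrakk>single_valued R; (x, y) \<in> R\<rbrakk> \<Longrightarrow> rel_app R x = y"
  unfolding rel_app_def by (rule the_equality) (auto dest: single_valuedD)

definition op_form ::
  "('k::complex_inner \<Rightarrow> 'k) \<Rightarrow> ('h \<times> 'k) set \<Rightarrow> 'h::complex_inner form" where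
  "op_form A R = mk_form (Domain R) (\<lambda>h k. cinner (A (rel_app R h)) (rel_app R k))"

lemma form_dom_op_form [simp]: "form_dom (op_form A R) = Domain R"
  by (simp add: op_form_def mk_form_def)

lemma form_val_op_form:
  "\<lbrakk>single_valued R; (x, y) \<in> R; (x', y') \<in> R\<rbrakk> \<Longrightarrow> form_val (op_form A R) x x' = cinner (A y) y'"
  by (auto simp: op_form_def mk_form_def rel_app_eq)

text \<open>\<open>S\<close> may be multivalued. The third assumption makes
  \<open>cinner \<phi>' \<psi>\<close> independent of the choice of \<open>\<phi>'\<close>, so that
  the description in \<open>form_of_rel\<close> denotes a value.\<close>

lemma form_of_rel_eq_op_form:
  assumes "single_valued R" "Domain S = Domain R"
    and "\<And>\<phi> \<phi>' x \<psi> y. \<lbrakk>(\<phi>, \<phi>') \<in> S; (\<phi>, x) \<in> R; (\<psi>, y) \<in> R\<rbrakk> \<Longrightarrow> cinner \<phi>' \<psi> = cinner (A x) y"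
  shows "form_of_rel S = op_form A R"
proof -
  have "(THE z. \<exists>\<phi>'. (\<phi>, \<phi>') \<in> S \<and> z = cinner \<phi>' \<psi>) = cinner (A (rel_app R \<phi>)) (rel_app R \<psi>)"
    if dom: "\<phi> \<in> Domain R" "\<psi> \<in> Domain R" for \<phi> \<psi>
  proof (rule the_equality)
    obtain x y where xy: "(\<phi>, x) \<in> R" "(\<psi>, y) \<in> R" using dom by blast
    have app: "rel_app R \<phi> = x" "rel_app R \<psi> = y" using rel_app_eq[OF assms(1)] xy by auto
    obtain \<phi>' where \<phi>': "(\<phi>, \<phi>') \<in> S" using dom(1) assms(2) by blast
    show "\<exists>\<phi>'. (\<phi>, \<phi>') \<in> S \<and> cinner (A (rel_app R \<phi>)) (rel_app R \<psi>) = cinner \<phi>' \<psi>"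
      using assms(3)[OF \<phi>' xy] \<phi>' app by auto
    show "z = cinner (A (rel_app R \<phi>)) (rel_app R \<psi>)"
      if "\<exists>\<phi>'. (\<phi>, \<phi>') \<in> S \<and> z = cinner \<phi>' \<psi>" for z
      using that assms(3) xy app by auto
  qed
  then show ?thesis
    unfolding form_of_rel_def op_form_def mk_form_def assms(2) by (auto intro!: ext)
qed

context coercive_map
begin

text \<open>The imaginary part is at most \<open>C * (norm x)\<^sup>2\<close> and the real part at
  least \<open>c * (norm x)\<^sup>2\<close>, so \<open>arctan (C / c)\<close> serves as
  semi-angle.\<close>

lemma sectorial_op_form:
  assumes R: "csubspace R" "single_valued R" "R \<subseteq> UNIV \<times> M"
  shows "sectorial_form (op_form A R)"
proof -
  let ?t = "op_form A R"
  note val = form_val_op_form[OF R(2)]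
  have "sesquilinear_form ?t"
    unfolding sesquilinear_form_def
  proof (intro conjI ballI allI impI)
    show "csubspace (form_dom ?t)" using csubspace_Domain[OF R(1)] by simp
    show "form_val ?t \<phi> \<psi> = 0" if "\<phi> \<notin> form_dom ?t \<or> \<psi> \<notin> form_dom ?t" for \<phi> \<psi>
      using that by (auto simp: op_form_def mk_form_def)
    fix \<phi> \<psi> \<theta> c assume "\<phi> \<in> form_dom ?t" "\<psi> \<in> form_dom ?t" "\<theta> \<in> form_dom ?t"
    then obtain x y z where p: "(\<phi>, x) \<in> R" "(\<psi>, y) \<in> R" "(\<theta>, z) \<in> R" by auto
    then have "x \<in> M" "y \<in> M" "z \<in> M" using R(3) by auto
    moreover note csubspace_pair_add[OF R(1) p(1,2)] csubspace_pair_scale[OF R(1) p(1), of c]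
    ultimately show "form_val ?t (\<phi> + \<psi>) \<theta> = form_val ?t \<phi> \<theta> + form_val ?t \<psi> \<theta>"
      "form_val ?t (c *\<^sub>C \<phi>) \<theta> = c * form_val ?t \<phi> \<theta>"
      "form_val ?t \<theta> (\<phi> + \<psi>) = form_val ?t \<theta> \<phi> + form_val ?t \<theta> \<psi>"
      "form_val ?t \<theta> (c *\<^sub>C \<phi>) = cnj c * form_val ?t \<theta> \<phi>"
      using p by (simp_all add: val add scale cinner_add_left cinner_add_right cinner_scaleC_left
          cinner_scaleC_right)
  qed
  moreover obtain c where c: "c > 0" "\<And>x. x \<in> M \<Longrightarrow> c * (norm x)\<^sup>2 \<le> Re (cinner (A x) x)"
    using coercive by blast
  obtain C where C: "C > 0" "\<And>x. x \<in> M \<Longrightarrow> norm (A x) \<le> C * norm x" using bounded by blast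
  have "\<forall>\<phi>\<in>form_dom ?t. 0 \<le> Re (form_val ?t \<phi> \<phi>) \<and>
        \<bar>Im (form_val ?t \<phi> \<phi>)\<bar> \<le> tan (arctan (C / c)) * Re (form_val ?t \<phi> \<phi>)"
  proof
    fix \<phi> assume "\<phi> \<in> form_dom ?t"
    then obtain x where x: "(\<phi>, x) \<in> R" by auto
    then have xM: "x \<in> M" using R(3) by auto
    have "0 \<le> c * (norm x)\<^sup>2" using c(1) by simp
    then have Re: "0 \<le> Re (cinner (A x) x)" using c(2)[OF xM] by linarith
    have "\<bar>Im (cinner (A x) x)\<bar> \<le> norm (A x) * norm x"
      using abs_Im_le_cmod cmod_cinner_le order_trans by blast
    also have "\<dots> \<le> C * norm x * norm x" using C(2)[OF xM] by (intro mult_right_mono) auto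
    also have "\<dots> = C / c * (c * (norm x)\<^sup>2)" using c(1) by (simp add: power2_eq_square)
    also have "\<dots> \<le> C / c * Re (cinner (A x) x)"
      using c C by (intro mult_left_mono c(2)[OF xM]) auto
    finally show "0 \<le> Re (form_val ?t \<phi> \<phi>) \<and>
        \<bar>Im (form_val ?t \<phi> \<phi>)\<bar> \<le> tan (arctan (C / c)) * Re (form_val ?t \<phi> \<phi>)"
      using Re by (simp add: val[OF x x] tan_arctan)
  qed
  moreover have "0 \<le> arctan (C / c)" "arctan (C / c) < pi / 2"
    using c C arctan_ubound[of "C / c"] by simp_all
  ultimately show ?thesis unfolding sectorial_form_def by blast
qed

lemma op_form_tendsto_0:
  assumes R: "csubspace R" "single_valued R" "R \<subseteq> UNIV \<times> M"
    and s: "\<And>n. (s n, y n) \<in> R" and l: "(\<phi>, z) \<in> R" "y \<longlonglongrightarrow> z"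
  shows "(\<lambda>n. form_val (op_form A R) (s n - \<phi>) (s n - \<phi>)) \<longlonglongrightarrow> 0"
proof -
  have M: "y n \<in> M" "z \<in> M" for n using s[of n] l(1) R(3) by auto
  have "(\<lambda>n. cinner (A (y n - z)) (y n - z)) \<longlonglongrightarrow> cinner (A 0) 0"
    using M l(2) by (intro cinner.tendsto tendsto) (simp_all add: LIM_zero)
  moreover have "form_val (op_form A R) (s n - \<phi>) (s n - \<phi>) = cinner (A (y n - z)) (y n - z)" for n
    using csubspace_pair_diff[OF R(1) s l(1), of n] by (simp add: form_val_op_form[OF R(2)])
  ultimately show ?thesis by simp
qed

text \<open>By coercivity a Cauchy sequence for the form has Cauchy images under \<open>R\<close>,
  and the closed graph contains the limit pair.\<close>

lemma closed_op_form:
  assumes R: "csubspace R" "single_valued R" "R \<subseteq> UNIV \<times> M" and "closed R"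
  shows "closed_sectorial_form (op_form A R)"
  unfolding closed_sectorial_form_def
proof (intro conjI allI impI)
  show "sectorial_form (op_form A R)" using R by (rule sectorial_op_form)
  let ?t = "op_form A R"
  obtain c where c: "c > 0" "\<And>x. x \<in> M \<Longrightarrow> c * (norm x)\<^sup>2 \<le> Re (cinner (A x) x)"
    using coercive by blast
  fix s \<phi>
  assume "(\<forall>n. s n \<in> form_dom ?t) \<and> s \<longlonglongrightarrow> \<phi> \<and>
    (\<forall>e>0. \<exists>N. \<forall>m\<ge>N. \<forall>n\<ge>N. cmod (form_val ?t (s n - s m) (s n - s m)) < e)"
  then have s: "\<And>n. s n \<in> Domain R" "s \<longlonglongrightarrow> \<phi>"
    and cauchy: "\<And>e. e > 0 \<Longrightarrow>
      \<exists>N. \<forall>m\<ge>N. \<forall>n\<ge>N. cmod (form_val ?t (s n - s m) (s n - s m)) < e"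
    by auto
  have "\<forall>n. \<exists>y. (s n, y) \<in> R" using s(1) by blast
  then obtain y where y: "\<And>n. (s n, y n) \<in> R" by metis
  have yM: "y n \<in> M" for n using y[of n] R(3) by auto
  have "Cauchy y"
  proof (rule CauchyI)
    fix e :: real assume "e > 0"
    then obtain N where N: "\<And>m n. \<lbrakk>m \<ge> N; n \<ge> N\<rbrakk> \<Longrightarrow> cmod (form_val ?t (s n - s m) (s n - s m)) < c * e\<^sup>2"
      using cauchy[of "c * e\<^sup>2"] c(1) by auto
    have "norm (y m - y n) < e" if "m \<ge> N" "n \<ge> N" for m n
    proof (rule power2_less_imp_less)
      have "c * (norm (y m - y n))\<^sup>2 \<le> Re (cinner (A (y m - y n)) (y m - y n))"
        using yM by (intro c(2)) simp
      also have "\<dots> \<le> cmod (cinner (A (y m - y n)) (y m - y n))" by (rule complex_Re_le_cmod)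
      also have "\<dots> < c * e\<^sup>2"
        using N[OF that(2,1)] csubspace_pair_diff[OF R(1) y y, of m n]
        by (simp add: form_val_op_form[OF R(2)])
      finally show "(norm (y m - y n))\<^sup>2 < e\<^sup>2" using c(1) by simp
    qed (use \<open>e > 0\<close> in simp)
    then show "\<exists>N. \<forall>m\<ge>N. \<forall>n\<ge>N. norm (y m - y n) < e" by blast
  qed
  then obtain l where l: "y \<longlonglongrightarrow> l" using convergent_eq_Cauchy by blast
  have "(\<phi>, l) \<in> R"
    using closed_sequentially[OF \<open>closed R\<close> y tendsto_Pair[OF s(2) l]] .
  then show "\<phi> \<in> form_dom ?t" by auto
  show "(\<lambda>n. form_val ?t (s n - \<phi>) (s n - \<phi>)) \<longlonglongrightarrow> 0"
    using R y \<open>(\<phi>, l) \<in> R\<close> l by (rule op_form_tendsto_0)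
qed

text \<open>With \<open>x\<close> the image of \<open>\<phi>\<close>, the defining condition of
  \<open>rel_of_form\<close> says that \<open>(A x, \<phi>')\<close> belongs to the adjoint of
  \<open>R\<close>.\<close>

lemma rel_of_op_form:
  assumes R: "single_valued R" "R \<subseteq> UNIV \<times> M"
  shows "rel_of_form (op_form A R) = rel_adjoint UNIV M R \<odot> graph_on M A \<odot> R"
proof -
  have "(\<phi>, \<phi>') \<in> rel_of_form (op_form A R) \<longleftrightarrow> (\<exists>x. (\<phi>, x) \<in> R \<and> (A x, \<phi>') \<in> rel_adjoint UNIV M R)"
    (is "?L \<longleftrightarrow> ?P") for \<phi> \<phi>'
  proof
    assume L: ?L
    then obtain x where x: "(\<phi>, x) \<in> R" by (auto simp: rel_of_form_def)
    have "cinner (A x) z = cinner \<phi>' \<psi>" if "(\<psi>, z) \<in> R" for \<psi> z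
      using L that by (auto simp: rel_of_form_def form_val_op_form[OF R(1) x that, symmetric])
    then have "(A x, \<phi>') \<in> rel_adjoint UNIV M R" using x R(2) by (auto simp: rel_adjoint_iff)
    then show ?P using x by blast
  next
    assume ?P
    then show ?L by (auto simp: rel_of_form_def rel_adjoint_iff form_val_op_form[OF R(1)])
  qed
  then have "rel_of_form (op_form A R)
      = {(\<phi>, \<phi>'). \<exists>x. (\<phi>, x) \<in> R \<and> (A x, \<phi>') \<in> rel_adjoint UNIV M R}"
    by auto
  also have "\<dots> = rel_adjoint UNIV M R \<odot> graph_on M A \<odot> R"
    using R(2) unfolding graph_on_def by blast
  finally show ?thesis .
qed

text \<open>The domain of \<open>R\<close> is a core for the form of \<open>closure R\<close>: for a
  sequence in \<open>R\<close> tending to a pair of the closure, first components converge in the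
  space, and convergence of the second components gives convergence in the form.\<close>

lemma form_closure_op_form:
  assumes R: "csubspace R" "R \<subseteq> UNIV \<times> M" and sv: "single_valued (closure R)"
  shows "form_closure (op_form A R) = op_form A (closure R)"
proof (rule form_closure_eq)
  have sub: "R \<subseteq> closure R" by (rule closure_subset)
  have svR: "single_valued R" using sv sub by (rule single_valued_subset[rotated])
  have cM: "closure R \<subseteq> UNIV \<times> M" using R(2) M(2) by (intro closure_minimal closed_Times) auto
  note cR = csubspace_closure[OF R(1)]
  show "closed_sectorial_form (op_form A (closure R))"
    using cR sv cM closed_closure by (rule closed_op_form)
  show "form_extends (op_form A (closure R)) (op_form A R)"
    unfolding form_extends_def
  proof (intro conjI ballI)
    show "form_dom (op_form A R) \<subseteq> form_dom (op_form A (closure R))" using sub by auto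
    fix \<phi> \<psi> assume "\<phi> \<in> form_dom (op_form A R)" "\<psi> \<in> form_dom (op_form A R)"
    then obtain x y where p: "(\<phi>, x) \<in> R" "(\<psi>, y) \<in> R" by auto
    then show "form_val (op_form A (closure R)) \<phi> \<psi> = form_val (op_form A R) \<phi> \<psi>"
      using sub by (simp add: form_val_op_form[OF sv subsetD subsetD] form_val_op_form[OF svR])
  qed
  show "form_core (form_dom (op_form A R)) (op_form A (closure R))"
    unfolding form_core_def
  proof (intro conjI ballI)
    show "csubspace (form_dom (op_form A R))" using csubspace_Domain[OF R(1)] by simp
    show "form_dom (op_form A R) \<subseteq> form_dom (op_form A (closure R))" using sub by auto
    fix \<phi> assume "\<phi> \<in> form_dom (op_form A (closure R))"
    then obtain z where z: "(\<phi>, z) \<in> closure R" by auto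
    then obtain p where p: "\<And>n. p n \<in> R" "p \<longlonglongrightarrow> (\<phi>, z)" unfolding closure_sequential by blast
    have "(fst (p n), snd (p n)) \<in> closure R" for n using p(1)[of n] sub by auto
    moreover have "(\<lambda>n. snd (p n)) \<longlonglongrightarrow> z" using tendsto_snd[OF p(2)] by simp
    ultimately have "(\<lambda>n. form_val (op_form A (closure R)) (fst (p n) - \<phi>) (fst (p n) - \<phi>)) \<longlonglongrightarrow> 0"
      by (intro op_form_tendsto_0[OF cR sv cM _ z])
    moreover have "fst (p n) \<in> form_dom (op_form A R)" for n
      using p(1)[of n] by (auto simp: Domain_fst)
    moreover have "(\<lambda>n. fst (p n)) \<longlonglongrightarrow> \<phi>" using tendsto_fst[OF p(2)] by simp
    ultimately show "\<exists>s. (\<forall>n. s n \<in> form_dom (op_form A R)) \<and> s \<longlonglongrightarrow> \<phi> \<and>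
        (\<lambda>n. form_val (op_form A (closure R)) (s n - \<phi>) (s n - \<phi>)) \<longlonglongrightarrow> 0"
      by (intro exI[of _ "\<lambda>n. fst (p n)"] conjI allI)
  qed
qed

text \<open>Applied with \<open>Q\<close> and \<open>A\<close> to \<open>S\<close>, and with
  \<open>J\<inverse>\<close> and the inverse of \<open>A\<close> to \<open>S\<inverse>\<close>. The
  adjoint of \<open>R\<close> itself appears because passing to the closure does not change
  it.\<close>

lemma friedrichs_ext_eq:
  fixes R :: "('h::chilbert_space \<times> 'k) set"
  assumes "csubspace R" "R \<subseteq> UNIV \<times> M" "single_valued (closure R)"
    and "form_of_rel S = op_form A R"
  shows "friedrichs_ext S = rel_of_form (op_form A (closure R))"
    and "friedrichs_ext S = rel_adjoint UNIV M R \<odot> graph_on M A \<odot> closure R"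
    and "closed_form_of (friedrichs_ext S) = op_form A (closure R)"
proof -
  have cM: "closure R \<subseteq> UNIV \<times> M" using assms(2) M(2) by (intro closure_minimal closed_Times) auto
  show eq: "friedrichs_ext S = rel_of_form (op_form A (closure R))"
    unfolding friedrichs_ext_def assms(4) form_closure_op_form[OF assms(1-3)] ..
  show "friedrichs_ext S = rel_adjoint UNIV M R \<odot> graph_on M A \<odot> closure R"
    unfolding eq rel_of_op_form[OF assms(3) cM] rel_adjoint_closure ..
  show "closed_form_of (friedrichs_ext S) = op_form A (closure R)"
    unfolding eq
    by (intro closed_form_of_rel_of_form closed_op_form csubspace_closure assms cM closed_closure)
qed

end

section \<open>The product T*(I + iB)T\<close>

locale sectorial_product =
  fixes T :: "('h::chilbert_space \<times> 'k::chilbert_space) set" and B :: "'k \<Rightarrow> 'k"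
  assumes T: "csubspace T" and clinear: "bounded_clinear B" and selfadjoint: "selfadjoint_op B"
begin

abbreviation "T_adj \<equiv> rel_adjoint UNIV UNIV T"
abbreviation "M0 \<equiv> M0_of T B"
abbreviation "M \<equiv> M_of T B"
abbreviation "A \<equiv> I_plus_i (Bm_of T B)"
abbreviation "Q \<equiv> Q_of T B"
abbreviation "J \<equiv> J_of T B"
abbreviation "S \<equiv> sect_product T B"

lemma B_linear: "B (x + y) = B x + B y" "B (c *\<^sub>C x) = c *\<^sub>C B x"
  using clinear unfolding bounded_clinear_def by (auto simp: linear_simps)

lemma cinner_B: "cinner (B x) y = cinner x (B y)"
proof -
  have "(x, B x) \<in> rel_adjoint UNIV UNIV (graph_on UNIV B)"
    using selfadjoint by (auto simp: selfadjoint_op_def graph_on_def)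
  then show ?thesis by (auto simp: rel_adjoint_iff graph_on_def)
qed

lemma I_plus_i_B_linear:
  "I_plus_i B (x + y) = I_plus_i B x + I_plus_i B y" "I_plus_i B (c *\<^sub>C x) = c *\<^sub>C I_plus_i B x"
  by (simp_all add: I_plus_i_def B_linear scaleC_add_right scaleC_scaleC mult.commute)

lemma I_plus_i_B_0 [simp]: "I_plus_i B 0 = 0"
  using I_plus_i_B_linear(1)[of 0 0] by simp

lemma csubspace_T_adj: "csubspace T_adj"
  by (intro csubspace_rel_adjoint complex_vector.subspace_UNIV)

lemma M0_iff: "\<alpha> \<in> M0 \<longleftrightarrow> (\<exists>\<phi>. (\<phi>, \<alpha>) \<in> T) \<and> (\<exists>\<psi>. (I_plus_i B \<alpha>, \<psi>) \<in> T_adj)"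
  by (auto simp: M0_of_def)

lemma csubspace_M0: "csubspace M0"
proof (rule complex_vector.subspaceI)
  show "0 \<in> M0"
    using csubspace_pair_0[OF T] csubspace_pair_0[OF csubspace_T_adj] by (auto simp: M0_iff)
  show "x + y \<in> M0" if "x \<in> M0" "y \<in> M0" for x y
    using that csubspace_pair_add[OF T] csubspace_pair_add[OF csubspace_T_adj]
    unfolding M0_iff I_plus_i_B_linear by blast
  show "c *\<^sub>C x \<in> M0" if "x \<in> M0" for c x
    using that csubspace_pair_scale[OF T] csubspace_pair_scale[OF csubspace_T_adj]
    unfolding M0_iff I_plus_i_B_linear by blast
qed

lemma csubspace_M: "csubspace M"
  unfolding M_of_def using csubspace_M0 by (rule csubspace_closure)

lemma closed_M: "closed M"
  by (simp add: M_of_def)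

lemma M0_subset: "M0 \<subseteq> M"
  unfolding M_of_def by (rule closure_subset)

lemma Bm_in: "Bm_of T B x \<in> M"
  unfolding Bm_of_def using csubspace_M closed_M by (rule orth_proj_in)

lemma cinner_Bm: "z \<in> M \<Longrightarrow> cinner (Bm_of T B x) z = cinner (B x) z"
  unfolding Bm_of_def using csubspace_M closed_M by (rule cinner_orth_proj_left)

text \<open>Testing against \<open>M\<close> removes the projection; by this identity the compressed
  operator replaces \<open>I + iB\<close> in all pairings.\<close>

lemma cinner_A: "z \<in> M \<Longrightarrow> cinner (A x) z = cinner (I_plus_i B x) z"
  by (simp add: I_plus_i_def cinner_add_left cinner_scaleC_left cinner_Bm)

lemma A_in: "x \<in> M \<Longrightarrow> A x \<in> M"
  unfolding I_plus_i_def using csubspace_M Bm_in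
  by (simp add: complex_vector.subspace_add complex_vector.subspace_scale)

sublocale coercive_map M A
proof
  show "csubspace M" "closed M" by (fact csubspace_M closed_M)+
  show "A x \<in> M" if "x \<in> M" for x using that by (rule A_in)
  \<comment> \<open>Both sides lie in \<open>M\<close>, so it suffices to test against
    \<open>M\<close>, where \<open>A\<close> may be replaced by the linear map
    \<open>I_plus_i B\<close>.\<close>
  show "A (x + y) = A x + A y" if "x \<in> M" "y \<in> M" for x y
    using that csubspace_M
    by (intro csubspace_cinner_eqI[OF csubspace_M])
      (simp_all add: A_in cinner_A cinner_add_left I_plus_i_B_linear complex_vector.subspace_add)
  show "A (a *\<^sub>C x) = a *\<^sub>C A x" if "x \<in> M" for a x
    using that csubspace_M
    by (intro csubspace_cinner_eqI[OF csubspace_M])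
      (simp_all add: A_in cinner_A cinner_scaleC_left I_plus_i_B_linear complex_vector.subspace_scale)
  obtain K where K: "\<And>x. norm (B x) \<le> norm x * K" "K \<ge> 0"
    using clinear bounded_linear.nonneg_bounded unfolding bounded_clinear_def by metis
  show "\<exists>C>0. \<forall>x\<in>M. norm (A x) \<le> C * norm x"
  proof (intro exI[of _ "1 + K"] conjI ballI)
    fix x
    \<comment> \<open>Testing \<open>Bm_of T B x\<close> against itself shows that the projection
      does not increase the norm of \<open>B x\<close>.\<close>
    have "(norm (Bm_of T B x))\<^sup>2 = cmod (cinner (B x) (Bm_of T B x))"
      using arg_cong[OF cinner_Bm[OF Bm_in, of x x], of cmod] by (simp add: cinner_self norm_power)
    also have "\<dots> \<le> norm (B x) * norm (Bm_of T B x)" by (rule cmod_cinner_le)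
    finally have "norm (Bm_of T B x) \<le> norm (B x)"
      by (cases "Bm_of T B x = 0") (simp_all add: power2_eq_square)
    then have "norm (\<i> *\<^sub>C Bm_of T B x) \<le> norm x * K"
      using K(1)[of x] by (simp add: norm_scaleC)
    then show "norm (A x) \<le> (1 + K) * norm x"
      unfolding I_plus_i_def using norm_triangle_ineq[of x "\<i> *\<^sub>C Bm_of T B x"]
      by (simp add: algebra_simps)
  qed (use K in simp)
  \<comment> \<open>Selfadjointness makes \<open>cinner (B x) x\<close> real, so
    \<open>\<i> *\<^sub>C B x\<close> contributes nothing to the real part and the constant is
    1.\<close>
  show "\<exists>c>0. \<forall>x\<in>M. c * (norm x)\<^sup>2 \<le> Re (cinner (A x) x)"
  proof (intro exI[of _ 1] conjI ballI)
    fix x assume "x \<in> M"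
    have "Im (cinner (B x) x) = 0"
      using cinner_commute[of "B x" x] cinner_B[of x x] by (simp add: complex_eq_iff)
    then show "1 * (norm x)\<^sup>2 \<le> Re (cinner (A x) x)"
      using \<open>x \<in> M\<close>
      by (simp add: cinner_A) (simp add: I_plus_i_def cinner_add_left cinner_scaleC_left cinner_self)
  qed simp
qed

lemma eq_0_if_orth_M0:
  assumes "x \<in> M" "\<And>\<beta>. \<beta> \<in> M0 \<Longrightarrow> cinner x \<beta> = 0"
  shows "x = 0"
proof -
  have "cinner x x = 0"
    using assms cinner_0_if_orth_closure[of M0 x x] by (simp add: M_of_def)
  then show ?thesis by (simp add: cinner_self)
qed

text \<open>\<open>A\<close> is continuous and maps \<open>M\<close> onto \<open>M\<close>, so it
  carries the dense set \<open>M0\<close> to a dense set. This image is the domain of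
  \<open>J\<close>.\<close>

lemma eq_0_if_orth_A_M0:
  assumes "x \<in> M" "\<And>\<beta>. \<beta> \<in> M0 \<Longrightarrow> cinner (A \<beta>) x = 0"
  shows "x = 0"
proof -
  obtain k where k: "k \<in> M" "A k = x" using surj[OF assms(1)] by blast
  obtain s where s: "\<And>n. s n \<in> M0" "s \<longlonglongrightarrow> k"
    using k(1) unfolding M_of_def closure_sequential by blast
  have "(\<lambda>n. cinner (A (s n)) x) \<longlonglongrightarrow> cinner (A k) x"
    using s k(1) M0_subset by (intro cinner.tendsto tendsto tendsto_const) auto
  then have "cinner (A k) x = 0" using assms(2) s(1) by (simp add: LIMSEQ_const_iff)
  then show ?thesis using k(2) by (simp add: cinner_self)
qed

section \<open>The relations \<open>Q\<close> and \<open>J\<close> and their duality\<close>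

lemma S_iff: "(\<phi>, \<phi>') \<in> S \<longleftrightarrow> (\<exists>\<alpha>. (\<phi>, \<alpha>) \<in> T \<and> (I_plus_i B \<alpha>, \<phi>') \<in> T_adj)"
  by (auto simp: sect_product_def graph_on_def)

lemma Q_iff: "(\<phi>, \<alpha>) \<in> Q \<longleftrightarrow> (\<phi>, \<alpha>) \<in> T \<and> \<alpha> \<in> M0"
  by (simp add: Q_of_def)

lemma J_iff: "(x, \<phi>') \<in> J \<longleftrightarrow> (\<exists>\<alpha>\<in>M0. x = A \<alpha> \<and> (I_plus_i B \<alpha>, \<phi>') \<in> T_adj)"
  by (auto simp: J_of_def)

lemma csubspace_Q: "csubspace Q"
proof (rule complex_vector.subspaceI)
  note T_ops = complex_vector.subspace_0[OF T] complex_vector.subspace_add[OF T]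
    complex_vector.subspace_scale[OF T]
  note M0_ops = complex_vector.subspace_0[OF csubspace_M0] complex_vector.subspace_add[OF csubspace_M0]
    complex_vector.subspace_scale[OF csubspace_M0]
  have Q: "x \<in> Q \<longleftrightarrow> x \<in> T \<and> snd x \<in> M0" for x by (cases x) (simp add: Q_iff)
  show "0 \<in> Q" "\<And>x y. \<lbrakk>x \<in> Q; y \<in> Q\<rbrakk> \<Longrightarrow> x + y \<in> Q" "\<And>c x. x \<in> Q \<Longrightarrow> c *\<^sub>C x \<in> Q"
    using T_ops M0_ops by (simp_all add: Q scaleC_prod_def)
qed

lemma csubspace_J: "csubspace J"
proof (rule complex_vector.subspaceI)
  show "0 \<in> J"
    using complex_vector.subspace_0[OF csubspace_M0] csubspace_pair_0[OF csubspace_T_adj]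
    by (auto simp: zero_prod_def J_iff intro!: bexI[of _ 0])
  fix x y c assume "x \<in> J"
  then obtain \<alpha> where \<alpha>: "\<alpha> \<in> M0" "fst x = A \<alpha>" "(I_plus_i B \<alpha>, snd x) \<in> T_adj"
    using J_iff[of "fst x" "snd x"] by auto
  have "(A (c *\<^sub>C \<alpha>), c *\<^sub>C snd x) \<in> J"
    unfolding J_iff using csubspace_pair_scale[OF csubspace_T_adj \<alpha>(3)]
      complex_vector.subspace_scale[OF csubspace_M0 \<alpha>(1)] by (metis I_plus_i_B_linear(2))
  then show "c *\<^sub>C x \<in> J"
    using \<alpha> M0_subset by (simp add: scaleC_prod_def scale subset_iff)
  assume "y \<in> J"
  then obtain \<beta> where \<beta>: "\<beta> \<in> M0" "fst y = A \<beta>" "(I_plus_i B \<beta>, snd y) \<in> T_adj"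
    using J_iff[of "fst y" "snd y"] by auto
  have "(A (\<alpha> + \<beta>), snd x + snd y) \<in> J"
    unfolding J_iff using csubspace_pair_add[OF csubspace_T_adj \<alpha>(3) \<beta>(3)]
      complex_vector.subspace_add[OF csubspace_M0 \<alpha>(1) \<beta>(1)] by (metis I_plus_i_B_linear(1))
  then show "x + y \<in> J"
    using \<alpha> \<beta> M0_subset by (simp add: plus_prod_def add subset_iff)
qed

lemma csubspace_converse_J: "csubspace (J\<inverse>)"
proof (rule complex_vector.subspaceI)
  show "0 \<in> J\<inverse>" using csubspace_pair_0[OF csubspace_J] by (simp add: zero_prod_def)
  show "x + y \<in> J\<inverse>" if "x \<in> J\<inverse>" "y \<in> J\<inverse>" for x y
    using that csubspace_pair_add[OF csubspace_J] by (auto simp: plus_prod_def)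
  show "c *\<^sub>C x \<in> J\<inverse>" if "x \<in> J\<inverse>" for c x
    using that csubspace_pair_scale[OF csubspace_J] by (auto simp: scaleC_prod_def)
qed

lemma Q_subset: "Q \<subseteq> UNIV \<times> M"
  using M0_subset by (auto simp: Q_iff)

lemma J_subset: "J \<subseteq> M \<times> UNIV"
  using M0_subset maps_to by (fastforce simp: J_iff)

text \<open>For \<open>(\<psi>, \<beta>)\<close> in \<open>Q\<close> the vector
  \<open>\<beta>\<close> lies in \<open>M\<close>, so \<open>A \<alpha>\<close> can be replaced by
  \<open>I_plus_i B \<alpha>\<close>; then \<open>(\<psi>, \<beta>) \<in> T\<close> and the
  definition of \<open>T_adj\<close> apply.\<close>

lemma J_subset_adjoint_Q: "J \<subseteq> rel_adjoint UNIV M Q"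
proof (rule subrelI)
  fix x \<phi>' assume "(x, \<phi>') \<in> J"
  then obtain \<alpha> where \<alpha>: "\<alpha> \<in> M0" "x = A \<alpha>" "(I_plus_i B \<alpha>, \<phi>') \<in> T_adj"
    by (auto simp: J_iff)
  have "cinner (A \<alpha>) \<beta> = cinner \<phi>' \<psi>" if "(\<psi>, \<beta>) \<in> Q" for \<psi> \<beta>
    using \<alpha>(3) that M0_subset by (auto simp: rel_adjoint_iff Q_iff cinner_A)
  then show "(x, \<phi>') \<in> rel_adjoint UNIV M Q"
    using \<alpha>(1,2) M0_subset by (auto simp: rel_adjoint_iff)
qed

lemma Q_subset_adjoint_J: "Q \<subseteq> rel_adjoint M UNIV J"
proof (rule subrelI)
  fix \<psi> \<beta> assume Q: "(\<psi>, \<beta>) \<in> Q"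
  have "cinner \<psi> \<phi>' = cinner \<beta> x" if "(x, \<phi>') \<in> J" for x \<phi>'
  proof -
    have "cinner x \<beta> = cinner \<phi>' \<psi>" using J_subset_adjoint_Q that Q by (auto simp: rel_adjoint_iff)
    then show ?thesis using cinner_commute by metis
  qed
  then show "(\<psi>, \<beta>) \<in> rel_adjoint M UNIV J"
    using Q Q_subset by (auto simp: rel_adjoint_iff)
qed

text \<open>If \<open>(0, x)\<close> is in the closure, pairing with \<open>J\<close> makes
  \<open>x\<close> orthogonal to the domain of \<open>J\<close>, which is dense in
  \<open>M\<close>.\<close>

lemma single_valued_closure_Q: "single_valued (closure Q)"
proof (rule single_valued_if_csubspace[OF csubspace_closure[OF csubspace_Q]])
  fix x assume x: "(0, x) \<in> closure Q"
  have "closure Q \<subseteq> UNIV \<times> M" using Q_subset closed_M by (intro closure_minimal closed_Times) auto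
  moreover have "cinner (A \<beta>) x = 0" if \<beta>: "\<beta> \<in> M0" for \<beta>
  proof -
    obtain \<psi> where "(I_plus_i B \<beta>, \<psi>) \<in> T_adj" using \<beta> unfolding M0_iff by blast
    then have "(A \<beta>, \<psi>) \<in> J" using \<beta> unfolding J_iff by blast
    then have "(A \<beta>, \<psi>) \<in> rel_adjoint UNIV M (closure Q)"
      unfolding rel_adjoint_closure using J_subset_adjoint_Q by blast
    then have "cinner (A \<beta>) x = cinner \<psi> 0" using x by (simp add: rel_adjoint_iff)
    then show ?thesis by simp
  qed
  ultimately show "x = 0" using x by (intro eq_0_if_orth_A_M0) auto
qed

text \<open>Here pairing with \<open>Q\<close> makes \<open>x\<close> orthogonal to the range
  \<open>M0\<close> of \<open>Q\<close>.\<close>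

lemma single_valued_closure_converse_J: "single_valued (closure (J\<inverse>))"
proof (rule single_valued_if_csubspace[OF csubspace_closure[OF csubspace_converse_J]])
  fix x assume x: "(0, x) \<in> closure (J\<inverse>)"
  have "closure (J\<inverse>) \<subseteq> UNIV \<times> M" using J_subset closed_M by (intro closure_minimal closed_Times) auto
  moreover have "cinner x \<beta> = 0" if \<beta>: "\<beta> \<in> M0" for \<beta>
  proof -
    obtain \<psi> where "(\<psi>, \<beta>) \<in> Q" using \<beta> unfolding Q_iff M0_iff by blast
    then have "(\<psi>, \<beta>) \<in> (rel_adjoint UNIV M (closure (J\<inverse>)))\<inverse>"
      unfolding rel_adjoint_closure converse_rel_adjoint using Q_subset_adjoint_J by auto
    then have "cinner \<beta> x = cinner \<psi> 0" using x by (simp add: rel_adjoint_iff)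
    then show ?thesis using cinner_commute[of x \<beta>] by simp
  qed
  ultimately show "x = 0" using x by (intro eq_0_if_orth_M0) auto
qed

abbreviation "Q_adj \<equiv> rel_adjoint UNIV M Q"
abbreviation "J_adj \<equiv> rel_adjoint M UNIV J"
abbreviation "J_adj_adj \<equiv> rel_adjoint UNIV M J_adj"

lemma Q_adj_adj: "rel_adjoint M UNIV Q_adj = closure Q"
  by (intro double_rel_adjoint complex_vector.subspace_UNIV closed_UNIV csubspace_M closed_M
      csubspace_Q Q_subset)

lemma J_adj_adj: "J_adj_adj = closure J"
  by (intro double_rel_adjoint complex_vector.subspace_UNIV closed_UNIV csubspace_M closed_M
      csubspace_J J_subset)

lemma single_valued_J_adj: "single_valued J_adj"
proof (rule single_valued_if_csubspace)
  show "csubspace J_adj" by (intro csubspace_rel_adjoint csubspace_M complex_vector.subspace_UNIV)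
  fix k assume k: "(0, k) \<in> J_adj"
  have "cinner (A \<beta>) k = 0" if \<beta>: "\<beta> \<in> M0" for \<beta>
  proof -
    obtain \<psi> where "(I_plus_i B \<beta>, \<psi>) \<in> T_adj" using \<beta> unfolding M0_iff by blast
    then have "(A \<beta>, \<psi>) \<in> J" using \<beta> unfolding J_iff by blast
    then have "cinner 0 \<psi> = cinner k (A \<beta>)" using k unfolding rel_adjoint_iff by blast
    then show ?thesis using cinner_commute[of "A \<beta>" k] by simp
  qed
  moreover have "k \<in> M" using k by (simp add: rel_adjoint_iff)
  ultimately show "k = 0" by (intro eq_0_if_orth_A_M0)
qed

text \<open>A vector may have many images under \<open>T\<close>, but the intermediate vector of a
  pair in \<open>S\<close> lies in \<open>M0\<close>. It is therefore the image under
  \<open>Q\<close>, which is unique.\<close>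

lemma form_of_rel_S: "form_of_rel S = op_form A Q"
proof (rule form_of_rel_eq_op_form)
  have sv: "single_valued Q"
    using single_valued_closure_Q closure_subset by (rule single_valued_subset[rotated])
  then show "single_valued Q" .
  have S_Q: "\<exists>\<alpha>. (\<phi>, \<alpha>) \<in> Q \<and> (I_plus_i B \<alpha>, \<phi>') \<in> T_adj" if "(\<phi>, \<phi>') \<in> S" for \<phi> \<phi>'
    using that unfolding S_iff Q_iff M0_iff by blast
  have "\<phi> \<in> Domain S" if "(\<phi>, \<alpha>) \<in> Q" for \<phi> \<alpha>
    using that unfolding Q_iff M0_iff Domain_iff S_iff by blast
  then show "Domain S = Domain Q" using S_Q by blast
  fix \<phi> \<phi>' \<alpha> \<psi> \<beta> assume *: "(\<phi>, \<phi>') \<in> S" "(\<phi>, \<alpha>) \<in> Q" "(\<psi>, \<beta>) \<in> Q"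
  have "(I_plus_i B \<alpha>, \<phi>') \<in> T_adj" using S_Q[OF *(1)] *(2) sv by (blast dest: single_valuedD)
  then have "(A \<alpha>, \<phi>') \<in> J" using *(2) unfolding J_iff Q_iff by blast
  then show "cinner \<phi>' \<psi> = cinner (A \<alpha>) \<beta>"
    using J_subset_adjoint_Q *(3) by (auto simp: rel_adjoint_iff)
qed

text \<open>If \<open>(\<phi>, \<phi>')\<close> in \<open>S\<close> passes through
  \<open>\<alpha>\<close>, then \<open>\<alpha>\<close> is the image of \<open>\<phi>\<close> under
  \<open>Q\<close> and \<open>A \<alpha>\<close> that of \<open>\<phi>'\<close> under
  \<open>J\<inverse>\<close>. Pairing \<open>Q\<close> with \<open>J\<close> turns
  \<open>cinner \<phi> \<psi>\<close> into \<open>cinner \<alpha> y\<close>, and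
  \<open>\<alpha>\<close> is recovered by inverting \<open>A\<close>.\<close>

lemma form_of_rel_converse_S: "form_of_rel (S\<inverse>) = op_form (inv_into M A) (J\<inverse>)"
proof (rule form_of_rel_eq_op_form)
  have sv: "single_valued (J\<inverse>)"
    using single_valued_closure_converse_J closure_subset by (rule single_valued_subset[rotated])
  then show "single_valued (J\<inverse>)" .
  have S_J: "\<exists>\<alpha>\<in>M0. (\<phi>, \<alpha>) \<in> Q \<and> (A \<alpha>, \<phi>') \<in> J" if S: "(\<phi>, \<phi>') \<in> S" for \<phi> \<phi>'
  proof -
    obtain \<alpha> where \<alpha>: "(\<phi>, \<alpha>) \<in> T" "(I_plus_i B \<alpha>, \<phi>') \<in> T_adj" using S unfolding S_iff by blast
    then have "\<alpha> \<in> M0" unfolding M0_iff by blast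
    moreover have "(A \<alpha>, \<phi>') \<in> J" using \<open>\<alpha> \<in> M0\<close> \<alpha>(2) unfolding J_iff by blast
    ultimately show ?thesis using \<alpha>(1) unfolding Q_iff by blast
  qed
  have "\<phi>' \<in> Range S" if J: "(x, \<phi>') \<in> J" for x \<phi>'
  proof -
    obtain \<alpha> where \<alpha>: "\<alpha> \<in> M0" "(I_plus_i B \<alpha>, \<phi>') \<in> T_adj" using J unfolding J_iff by blast
    obtain \<phi> where "(\<phi>, \<alpha>) \<in> T" using \<alpha>(1) unfolding M0_iff by blast
    then have "(\<phi>, \<phi>') \<in> S" using \<alpha>(2) unfolding S_iff by blast
    then show ?thesis by blast
  qed
  then show "Domain (S\<inverse>) = Domain (J\<inverse>)" using S_J by blast
  fix \<phi> \<phi>' x \<psi> y assume *: "(\<phi>', \<phi>) \<in> S\<inverse>" "(\<phi>', x) \<in> J\<inverse>" "(\<psi>, y) \<in> J\<inverse>"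
  obtain \<alpha> where \<alpha>: "\<alpha> \<in> M0" "(\<phi>, \<alpha>) \<in> Q" "(A \<alpha>, \<phi>') \<in> J" using S_J * by blast
  then have "x = A \<alpha>" using *(2) sv by (blast dest: single_valuedD)
  then have "inv_into M A x = \<alpha>" using \<alpha>(1) M0_subset by (auto intro: inv_left)
  then show "cinner \<phi> \<psi> = cinner (inv_into M A x) y"
    using Q_subset_adjoint_J \<alpha>(2) *(3) by (auto simp: rel_adjoint_iff)
qed

section \<open>The two extensions and the density criterion\<close>

lemma friedrichs_ext_S:
  shows "friedrichs_ext S = Q_adj \<odot> graph_on M A \<odot> closure Q"
    and "closed_form_of (friedrichs_ext S) = op_form A (closure Q)"
  using friedrichs_ext_eq[OF csubspace_Q Q_subset single_valued_closure_Q form_of_rel_S] by blast+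

text \<open>Adjoints commute with inversion, so the Friedrichs formula for
  \<open>S\<inverse>\<close> is a product of inverses of \<open>J_adj_adj\<close>, \<open>A\<close>
  and \<open>J_adj\<close>. Inverting it reverses the order and removes them.\<close>

lemma krein_ext_S: "krein_ext S = J_adj_adj \<odot> graph_on M A \<odot> J_adj"
proof -
  interpret inv: coercive_map M "inv_into M A" by (rule inverse)
  have adj: "rel_adjoint UNIV M (J\<inverse>) = J_adj\<inverse>" by (simp add: converse_rel_adjoint)
  have "closure (J\<inverse>) = rel_adjoint M UNIV (J_adj\<inverse>)"
    using csubspace_converse_J J_subset csubspace_M closed_M
    by (subst adj[symmetric], intro double_rel_adjoint[symmetric])
      (auto simp: complex_vector.subspace_UNIV)
  also have "\<dots> = J_adj_adj\<inverse>" by (simp add: converse_rel_adjoint)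
  finally have cl: "closure (J\<inverse>) = J_adj_adj\<inverse>" .
  have "J\<inverse> \<subseteq> UNIV \<times> M" using J_subset by auto
  then have "friedrichs_ext (S\<inverse>) = J_adj\<inverse> \<odot> (graph_on M A)\<inverse> \<odot> J_adj_adj\<inverse>"
    using inv.friedrichs_ext_eq(2)[OF csubspace_converse_J _ single_valued_closure_converse_J
        form_of_rel_converse_S]
    unfolding adj cl graph_on_inv by blast
  then show ?thesis by (simp add: krein_ext_def converse_relcomp O_assoc)
qed

text \<open>\<open>J_adj\<close> is itself a closed operator into \<open>M\<close>, so its form is
  closed, and the relation of that form is the product just found. Closed form and maximality follow
  without returning to \<open>S\<inverse>\<close>.\<close>

lemma
  shows closed_form_krein_ext: "closed_form_of (krein_ext S) = op_form A J_adj"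
    and maximal_sectorial_krein_ext: "maximal_sectorial (krein_ext S)"
proof -
  have sub: "J_adj \<subseteq> UNIV \<times> M" by (auto simp: rel_adjoint_iff)
  have closed: "closed_sectorial_form (op_form A J_adj)"
    by (intro closed_op_form csubspace_rel_adjoint csubspace_M complex_vector.subspace_UNIV
        single_valued_J_adj sub closed_rel_adjoint closed_M closed_UNIV)
  have eq: "krein_ext S = rel_of_form (op_form A J_adj)"
    unfolding krein_ext_S rel_of_op_form[OF single_valued_J_adj sub] ..
  show "closed_form_of (krein_ext S) = op_form A J_adj"
    unfolding eq using closed by (rule closed_form_of_rel_of_form)
  show "maximal_sectorial (krein_ext S)"
    unfolding eq by (intro closed_form.maximal_sectorial_rel_of_form closed_formI closed)
qed

text \<open>A pair of \<open>S\<close> factors through \<open>Q\<close>, \<open>A\<close> and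
  \<open>J\<close>; here \<open>Q\<close> is contained in \<open>J_adj\<close> and \<open>J\<close>
  in its closure \<open>J_adj_adj\<close>.\<close>

lemma S_subset_krein_ext: "S \<subseteq> krein_ext S"
proof (rule subrelI)
  fix \<phi> \<phi>' assume "(\<phi>, \<phi>') \<in> S"
  then obtain \<alpha> where \<alpha>: "(\<phi>, \<alpha>) \<in> T" "(I_plus_i B \<alpha>, \<phi>') \<in> T_adj" unfolding S_iff by blast
  then have "\<alpha> \<in> M0" unfolding M0_iff by blast
  then have "(\<phi>, \<alpha>) \<in> Q" "(A \<alpha>, \<phi>') \<in> J" "\<alpha> \<in> M" using \<alpha> M0_subset unfolding Q_iff J_iff by blast+
  moreover have "J \<subseteq> J_adj_adj" unfolding J_adj_adj by (rule closure_subset)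
  ultimately show "(\<phi>, \<phi>') \<in> krein_ext S"
    unfolding krein_ext_S graph_on_def using Q_subset_adjoint_J by blast
qed

lemma dense_if_single_valued_extension:
  assumes "S \<subseteq> H" "single_valued H"
  shows "closure (Domain T) = UNIV"
proof -
  have "single_valued T_adj"
  proof (rule single_valued_if_csubspace[OF csubspace_T_adj])
    fix h assume h: "(0, h) \<in> T_adj"
    \<comment> \<open>Both pairs pass through the intermediate vector 0, which \<open>T\<close>
      relates to 0.\<close>
    have "(0, h) \<in> S" "(0, 0) \<in> S"
      using h csubspace_pair_0[OF T] csubspace_pair_0[OF csubspace_T_adj] unfolding S_iff
      by (metis I_plus_i_B_0)+
    then show "h = 0" using assms by (blast dest: single_valuedD)
  qed
  then show ?thesis by (simp add: single_valued_rel_adjoint_iff[OF T UNIV_I])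
qed

text \<open>For \<open>(h, y) \<in> T\<close>, the vector \<open>k \<in> M\<close> with \<open>(h, k) \<in> J_adj\<close> solves the adjoint equation for the coercive
  operator \<open>A\<close> on \<open>M\<close>; in general it is not the projection of \<open>y\<close>.\<close>

lemma Domain_T_subset: "Domain T \<subseteq> Domain J_adj"
proof
  fix h assume "h \<in> Domain T"
  then obtain y where y: "(h, y) \<in> T" by blast
  obtain k where k: "k \<in> M" "\<And>x. x \<in> M \<Longrightarrow> cinner k (A x) = cinner (y - \<i> *\<^sub>C B y) x"
    using adjoint_surj by blast
  \<comment> \<open>As \<open>B\<close> is selfadjoint, \<open>y - \<i> *\<^sub>C B y\<close> is the
    adjoint of \<open>I + iB\<close> applied to \<open>y\<close>.\<close>
  have adj: "cinner (y - \<i> *\<^sub>C B y) x = cinner y (I_plus_i B x)" for x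
    by (simp add: I_plus_i_def cinner.diff_left cinner_add_right cinner_scaleC_left
        cinner_scaleC_right cinner_B)
  have "cinner h \<phi>' = cinner k x" if J: "(x, \<phi>') \<in> J" for x \<phi>'
  proof -
    obtain \<alpha> where \<alpha>: "\<alpha> \<in> M0" "x = A \<alpha>" "(I_plus_i B \<alpha>, \<phi>') \<in> T_adj"
      using J unfolding J_iff by blast
    have "cinner (I_plus_i B \<alpha>) y = cinner \<phi>' h" using \<alpha>(3) y by (simp add: rel_adjoint_iff)
    then have "cinner y (I_plus_i B \<alpha>) = cinner h \<phi>'" using cinner_commute by metis
    then show ?thesis using k(2)[of \<alpha>] \<alpha>(1,2) M0_subset adj by auto
  qed
  then have "(h, k) \<in> J_adj" using k(1) by (simp add: rel_adjoint_iff)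
  then show "h \<in> Domain J_adj" by blast
qed

text \<open>Of the three factors only \<open>J_adj_adj\<close> can be multivalued, and it is an
  operator once \<open>J_adj\<close> is densely defined.\<close>

lemma single_valued_krein_ext:
  assumes "closure (Domain T) = UNIV"
  shows "single_valued (krein_ext S)"
proof -
  have "closure (Domain J_adj) = UNIV"
    using assms closure_mono[OF Domain_T_subset] by blast
  moreover have "csubspace J_adj"
    by (intro csubspace_rel_adjoint csubspace_M complex_vector.subspace_UNIV)
  ultimately have "single_valued J_adj_adj"
    by (simp add: single_valued_rel_adjoint_iff)
  moreover have "single_valued (graph_on M A)" by (auto simp: graph_on_def single_valued_def)
  ultimately show ?thesis
    unfolding krein_ext_S using single_valued_J_adj by (intro single_valued_relcomp)
qed

end

theorem theorem2p9:
  fixes T :: "('h::chilbert_space \<times> 'k::chilbert_space) set"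
    and B Bm :: "'k \<Rightarrow> 'k"
    and S :: "('h \<times> 'h) set"
    and M :: "'k set"
    and Q Qss Js :: "('h \<times> 'k) set"
    and J Qs Jss :: "('k \<times> 'h) set"
  assumes "csubspace T"
    and "bounded_clinear B" and "selfadjoint_op B"
    and "S = sect_product T B"
    and "M = M_of T B" and "Bm = Bm_of T B"
    and "Q = Q_of T B" and "Qs = rel_adjoint UNIV M Q" and "Qss = rel_adjoint M UNIV Qs"
    and "J = J_of T B" and "Js = rel_adjoint M UNIV J" and "Jss = rel_adjoint UNIV M Js"
  shows
    "friedrichs_ext S = Qs \<odot> graph_on M (I_plus_i Bm) \<odot> Qss \<and>
     closed_form_of (friedrichs_ext S) =
       mk_form (Domain Qss) (\<lambda>h k. cinner (I_plus_i Bm (rel_app Qss h)) (rel_app Qss k)) \<and>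
     krein_ext S = Jss \<odot> graph_on M (I_plus_i Bm) \<odot> Js \<and>
     closed_form_of (krein_ext S) =
       mk_form (Domain Js) (\<lambda>h k. cinner (I_plus_i Bm (rel_app Js h)) (rel_app Js k)) \<and>
     (single_valued (krein_ext S) \<longleftrightarrow> closure (Domain T) = UNIV) \<and>
     ((\<exists>H. S \<subseteq> H \<and> maximal_sectorial H \<and> single_valued H) \<longleftrightarrow> closure (Domain T) = UNIV)"
proof -
  interpret sectorial_product T B by standard fact+
  have Qss: "Qss = closure Q" using assms(5,7-9) Q_adj_adj by simp
  have dense: "single_valued (krein_ext S) \<longleftrightarrow> closure (Domain T) = UNIV"
    using dense_if_single_valued_extension[OF S_subset_krein_ext] single_valued_krein_ext
    unfolding assms(4) by blast
  \<comment> \<open>If \<open>T\<close> is densely defined, the Krein extension is the witness for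
    \<open>H\<close>.\<close>
  have "(\<exists>H. S \<subseteq> H \<and> maximal_sectorial H \<and> single_valued H) \<longleftrightarrow> closure (Domain T) = UNIV"
    using dense_if_single_valued_extension S_subset_krein_ext maximal_sectorial_krein_ext dense
    unfolding assms(4) by blast
  with dense show ?thesis
    unfolding Qss op_form_def[symmetric]
    using friedrichs_ext_S krein_ext_S closed_form_krein_ext
    by (simp only: assms(4-8,10-12))
qed

end
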